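(* Let $d\ge 1$, $n\ge 1$, and let $T_1,\dots,T_n\ge 2$ be integers. Let $\mathbf W\in\mathbb R^{d\times d}$ be such that $\Sigma=\mathbf W\mathbf W^\top$ is positive definite. Let $\bar{\mathbf s}_1,\dots,\bar{\mathbf s}_n$ be independent sequences, where $\bar{\mathbf s}_i$ has length $T_i+1$ and is generated by the Brownian bridge model (see context) on $[0,T_i]$ with the same matrix $\mathbf W$ for all $i$ (equivalently, the same $\Sigma$), with fixed start and end points. Let $\mathbf s_i,\boldsymbol\mu_i\in\mathbb R^{d\times(T_i-1)}$ be the matrices of interior points and of interior means of the $i$-th sequence, and for an integer $T\ge 2$ let $\Sigma_T\in\mathbb R^{(T-1)\times(T-1)}$ be the symmetric matrix with entries $[\Sigma_T]_{s,t}=s(T-t)/T$ for $1\le s\le t\le T-1$. Then the log-likelihood function of $\Sigma$ given $\bar{\mathbf s}_1,\dots,\bar{\mathbf s}_n$ (the logarithm of the joint density of the interior points with respect to Lebesgue measure, the start and end points being fixed) is $$\ell(\Sigma\mid\{\bar{\mathbf s}_i\}_{i=1}^n)=\frac12\Big(-d\log(2\pi)\sum_{i=1}^n(T_i-1)-d\sum_{i=1}^n\log|\Sigma_{T_i}|-\log|\Sigma|\sum_{i=1}^n(T_i-1)-\sum_{i=1}^n\operatorname{tr}\big(\Sigma^{-1}(\mathbf s_i-\boldsymbol\mu_i)\Sigma_{T_i}^{-1}(\mathbf s_i-\boldsymbol\mu_i)^\top\big)\Big).$$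
   Context: A standard Brownian bridge on $[0,T]$ is the centered Gaussian process $\{B(t):t\in[0,T]\}$ with $B(0)=B(T)=0$, $B(t)\sim N(0,t(T-t)/T)$, and $\operatorname{Cov}(B(s),B(t))=s(T-t)/T$ for $s<t$. Brownian bridge model on $[0,T]$ with matrix $\mathbf W\in\mathbb R^{d\times d}$: a sequence $\bar{\mathbf s}=(s_0,\dots,s_T)$ with $s_t\in\mathbb R^d$, fixed start point $s_0$ and end point $s_T$, such that for $t=0,1,\dots,T$ $$s_t=\mu_t+\mathbf W(B_1(t),\dots,B_d(t))^\top,\qquad \mu_t=s_0+\tfrac tT(s_T-s_0),$$ where $B_1,\dots,B_d$ are independent standard Brownian bridges on $[0,T]$. Put $\Sigma=\mathbf W\mathbf W^\top$. The interior points and interior means are collected as the $d\times(T-1)$ matrices $\mathbf s=(s_1,\dots,s_{T-1})$ and $\boldsymbol\mu=(\mu_1,\dots,\mu_{T-1})$, whose $t$-th columns are $s_t$ and $\mu_t$. $|A|$ denotes the determinant of a square matrix $A$. *)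

theory Defs
  imports
    "HOL-Probability.Probability"
    "Jordan_Normal_Form.Determinant"
    "Jordan_Normal_Form.Gauss_Jordan_Elimination"
begin

(* Both HOL-Analysis and Jordan_Normal_Form are in scope.  Vectors and matrices of the
   fixed dimension d live in real^'d and real^'d^'d; the matrices whose size T - 1 varies
   with the sequence are Jordan_Normal_Form matrices. *)
no_notation Matrix.vec_index (infixl "$" 100)
no_notation Matrix.scalar_prod (infix "\<bullet>" 70)

definition positive_definite :: "real^'d^'d \<Rightarrow> bool" where
  "positive_definite A \<longleftrightarrow>
     Finite_Cartesian_Product.transpose A = A \<and> (\<forall>x. x \<noteq> 0 \<longrightarrow> 0 < x \<bullet> (A *v x))"

(* X ~ N(m, v), where v is the variance; v = 0 is the point mass at m. *)
definition normal_law :: "'a measure \<Rightarrow> ('a \<Rightarrow> real) \<Rightarrow> real \<Rightarrow> real \<Rightarrow> bool" where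
  "normal_law M X m v \<longleftrightarrow>
     X \<in> borel_measurable M \<and> 0 \<le> v \<and>
     distr M borel X =
       (if v = 0 then return borel m else density lborel (normal_density m (sqrt v)))"

definition gaussian_process :: "'a measure \<Rightarrow> 't set \<Rightarrow> ('t \<Rightarrow> 'a \<Rightarrow> real) \<Rightarrow> bool" where
  "gaussian_process M I X \<longleftrightarrow>
     (\<forall>J c. finite J \<and> J \<subseteq> I \<longrightarrow> (\<exists>m v. normal_law M (\<lambda>\<omega>. \<Sum>t\<in>J. c t * X t \<omega>) m v))"

definition covariance :: "'a measure \<Rightarrow> ('a \<Rightarrow> real) \<Rightarrow> ('a \<Rightarrow> real) \<Rightarrow> real" where
  "covariance M X Y =
     (\<integral>\<omega>. (X \<omega> - (\<integral>\<omega>'. X \<omega>' \<partial>M)) * (Y \<omega> - (\<integral>\<omega>'. Y \<omega>' \<partial>M)) \<partial>M)"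

definition brownian_bridge :: "'a measure \<Rightarrow> real \<Rightarrow> (real \<Rightarrow> 'a \<Rightarrow> real) \<Rightarrow> bool" where
  "brownian_bridge M T B \<longleftrightarrow>
     gaussian_process M {0..T} B \<and>
     (AE \<omega> in M. B 0 \<omega> = 0) \<and> (AE \<omega> in M. B T \<omega> = 0) \<and>
     (\<forall>t\<in>{0..T}. normal_law M (B t) 0 (t * (T - t) / T)) \<and>
     (\<forall>s\<in>{0..T}. \<forall>t\<in>{0..T}. s < t \<longrightarrow> covariance M (B s) (B t) = s * (T - t) / T)"

definition bridge_mean :: "real^'d \<Rightarrow> real^'d \<Rightarrow> nat \<Rightarrow> nat \<Rightarrow> real^'d" where
  "bridge_mean a b T t = a + (real t / real T) *\<^sub>R (b - a)"

(* The independence of the components is that of the whole paths (B_k(t))_{0 <= t <= T}. *)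
definition bridge_model ::
  "'a measure \<Rightarrow> real^'d^'d \<Rightarrow> nat \<Rightarrow> real^'d \<Rightarrow> real^'d \<Rightarrow> (nat \<Rightarrow> 'a \<Rightarrow> real^'d) \<Rightarrow> bool" where
  "bridge_model M W T a b S \<longleftrightarrow>
     (\<exists>B :: 'd \<Rightarrow> real \<Rightarrow> 'a \<Rightarrow> real.
        (\<forall>k. brownian_bridge M (real T) (B k)) \<and>
        prob_space.indep_vars M (\<lambda>_. Pi\<^sub>M {0..real T} (\<lambda>_. borel))
          (\<lambda>k \<omega>. \<lambda>t\<in>{0..real T}. B k t \<omega>) UNIV \<and>
        (\<forall>t\<in>{0..T}. \<forall>\<omega>\<in>space M.
           S t \<omega> = bridge_mean a b T t + W *v (\<chi> k. B k (real t) \<omega>)))"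

(* Jordan_Normal_Form indices start at 0: position (u, v) holds the entry for the times
   u + 1 and v + 1. *)
definition bridge_cov :: "nat \<Rightarrow> real Matrix.mat" where
  "bridge_cov T = Matrix.mat (T - 1) (T - 1)
     (\<lambda>(u, v). let s = min (u + 1) (v + 1); t = max (u + 1) (v + 1)
               in real s * (real T - real t) / real T)"

(* Partial inverse: meaningful for invertible A only. *)
definition inverse_mat :: "real Matrix.mat \<Rightarrow> real Matrix.mat" where
  "inverse_mat A = the (mat_inverse A)"

(* A d x m matrix D is represented by its columns D 1, ..., D m in real^'d.  For an
   m x m matrix C, conj_by D C is the d x d matrix product D C D^T, written out because its
   outer and inner dimensions belong to different libraries. *)
definition conj_by :: "(nat \<Rightarrow> real^'d) \<Rightarrow> real Matrix.mat \<Rightarrow> real^'d^'d" where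
  "conj_by D C = (\<chi> k l. \<Sum>u<dim_row C. \<Sum>v<dim_col C.
     D (u + 1) $ k * C $$ (u, v) * D (v + 1) $ l)"

(* The interior points of all sequences; the point x (i, t) is the one at time t in sequence i. *)
definition interior_index :: "nat \<Rightarrow> (nat \<Rightarrow> nat) \<Rightarrow> (nat \<times> nat) set" where
  "interior_index n T = (SIGMA i:{1..n}. {1..T i - 1})"

definition interior_lebesgue :: "nat \<Rightarrow> (nat \<Rightarrow> nat) \<Rightarrow> (nat \<times> nat \<Rightarrow> real^'d) measure" where
  "interior_lebesgue n T = Pi\<^sub>M (interior_index n T) (\<lambda>_. lborel)"

definition interior_points ::
  "nat \<Rightarrow> (nat \<Rightarrow> nat) \<Rightarrow> (nat \<Rightarrow> nat \<Rightarrow> 'a \<Rightarrow> real^'d) \<Rightarrow> 'a \<Rightarrow> (nat \<times> nat \<Rightarrow> real^'d)" where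
  "interior_points n T S \<omega> = (\<lambda>(i, t)\<in>interior_index n T. S i t \<omega>)"

(* l is the logarithm of a density of X with respect to N.  Densities are determined only up
   to N-null sets, so this says that some everywhere positive version f has ln f = l at
   every point. *)
definition is_log_likelihood ::
  "'a measure \<Rightarrow> 'b measure \<Rightarrow> ('a \<Rightarrow> 'b) \<Rightarrow> ('b \<Rightarrow> real) \<Rightarrow> bool" where
  "is_log_likelihood M N X l \<longleftrightarrow>
     (\<exists>f :: 'b \<Rightarrow> real. distributed M N X (\<lambda>x. ennreal (f x)) \<and>
        (\<forall>x\<in>space N. 0 < f x \<and> l x = ln (f x)))"

end

(* Write y_t = s_t - mu_t. The innovations y_t - rho_t y_(t-1), with
   rho_t = (T - t) / (T - t + 1) for t >= 2, are the images under W of uncorrelated jointly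
   Gaussian variables of variance (T - t) / (T - t + 1), hence independent: the joint characteristic
   function factorizes. (With rho_1 = 0, time 0 does not enter, where the bridge vanishes only
   almost surely.) Recovering the interior points from the innovations is a composition of shears,
   which preserve Lebesgue measure, so the joint density is a product of d-dimensional Gaussian
   densities. The same recursion makes Sigma_T triangular, so that |Sigma_T| is the product of the
   innovation variances, and the sum of the squared normalized innovations is the quadratic form of
   the tridiagonal inverse of Sigma_T. *)
theory Submission
  imports Defs
begin

text \<open>\<open>gaussian_process\<close> gives only the laws of scalar linear combinations, so no
  joint law is available at the outset. These laws determine the joint characteristic function, and
  Levy uniqueness is applied to one real variable at a time, the coordinates already treated being
  absorbed into a bounded weight. For t >= 2 the number (T - t) / (T - t + 1) is both the regression
  coefficient rho_t and the residual variance v_t. This coincidence produces the integer entries of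
  the inverse covariance: the off-diagonal entry is -rho_t / v_t = -1, and the diagonal entry is 1 /
  v_t + rho_(t+1)^2 / v_(t+1) = 1 / v_t + v_(t+1) = 2. Independence is needed across components,
  times and sequences. It is given for whole component paths and whole sequences, and derived for
  times; the levels are joined on pairs of indices. \<open>W\<close> is any invertible factor of
  \<Sigma>, so vectors are whitened by the inverse of \<open>W\<close>. \<Sigma> itself appears only
  at the end, through det \<Sigma> = (det W)^2 and \<Sigma>^-1 = V^T V with V the inverse of
  W.\<close>

section \<open>Independence from characteristic functions\<close>

text \<open>If \<kappa> > 0, then u / \<kappa> is a probability density with respect to
  \<open>M\<close>, and under the new measure \<open>X\<close> has the same characteristic function
  as under \<open>M\<close>, hence the same law. If \<kappa> = 0, normalization is impossible, but
  then \<open>u\<close> vanishes almost everywhere.\<close>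

lemma weighted_char_determines:
  fixes X :: "'a \<Rightarrow> real" and u :: "'a \<Rightarrow> real"
  assumes "prob_space M"
    and X: "X \<in> borel_measurable M" and u: "u \<in> borel_measurable M"
    and nn: "\<And>\<omega>. \<omega> \<in> space M \<Longrightarrow> 0 \<le> u \<omega>" and bd: "\<And>\<omega>. \<omega> \<in> space M \<Longrightarrow> u \<omega> \<le> K"
    and char: "\<And>s. (\<integral>\<omega>. complex_of_real (u \<omega>) * iexp (s * X \<omega>) \<partial>M)
                     = complex_of_real \<kappa> * (\<integral>\<omega>. iexp (s * X \<omega>) \<partial>M)"
    and B: "B \<in> sets borel"
  shows "(\<integral>\<omega>. u \<omega> * indicator B (X \<omega>) \<partial>M) = \<kappa> * measure M (X -` B \<inter> space M)"
proof -
  interpret prob_space M by fact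
  note X[measurable] u[measurable]
  have int_u: "integrable M u"
    by (rule integrable_const_bound[of _ K]) (use nn bd in auto)
  have int_uB: "integrable M (\<lambda>\<omega>. u \<omega> * indicator B (X \<omega>))"
    by (rule integrable_const_bound[of _ "\<bar>K\<bar>"])
       (use nn bd B in \<open>auto simp: indicator_def intro!: AE_I2 order_trans[OF _ abs_ge_self]\<close>)
  \<comment> \<open>Frequency 0 identifies \<kappa> as the total mass of the weight.\<close>
  have "complex_of_real (\<integral>\<omega>. u \<omega> \<partial>M) = complex_of_real \<kappa>"
    using char[of 0] by (simp add: prob_space)
  then have \<kappa>: "(\<integral>\<omega>. u \<omega> \<partial>M) = \<kappa>" using of_real_eq_iff by blast
  then have "0 \<le> \<kappa>" using nn by (auto intro!: integral_nonneg_AE)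
  show ?thesis
  proof (cases "\<kappa> = 0")
    case True
    then have "AE \<omega> in M. u \<omega> = 0"
      using \<kappa> int_u nn by (subst integral_nonneg_eq_0_iff_AE[symmetric]) auto
    then have "(\<integral>\<omega>. u \<omega> * indicator B (X \<omega>) \<partial>M) = (\<integral>\<omega>. 0 \<partial>M)"
      using B by (intro integral_cong_AE) auto
    then show ?thesis using True by simp
  next
    case False
    then have "\<kappa> > 0" using \<open>0 \<le> \<kappa>\<close> by simp
    define N where "N = density M (\<lambda>\<omega>. u \<omega> / \<kappa>)"
    have nn': "AE \<omega> in M. 0 \<le> u \<omega> / \<kappa>" using nn \<open>\<kappa> > 0\<close> by auto
    have [measurable]: "(\<lambda>\<omega>. u \<omega> / \<kappa>) \<in> borel_measurable M" by simp
    have [measurable]: "X \<in> borel_measurable N" by (simp add: N_def)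
    interpret N: prob_space N
    proof
      have "emeasure N (space N) = (\<integral>\<^sup>+\<omega>. ennreal (u \<omega> / \<kappa>) \<partial>M)"
        unfolding N_def by (simp add: emeasure_density cong: nn_integral_cong)
      also have "\<dots> = ennreal (\<integral>\<omega>. u \<omega> / \<kappa> \<partial>M)"
        using int_u nn' by (intro nn_integral_eq_integral) auto
      also have "\<dots> = 1" using \<kappa> \<open>\<kappa> > 0\<close> by simp
      finally show "emeasure N (space N) = 1" .
    qed
    have "distr N borel X = distr M borel X"
    proof (rule Levy_uniqueness)
      show "real_distribution (distr N borel X)" by (rule N.real_distribution_distr) simp
      show "real_distribution (distr M borel X)" by (rule real_distribution_distr) simp
      show "char (distr N borel X) = char (distr M borel X)"
      proof
        fix s
        have "char (distr N borel X) s = (\<integral>\<omega>. iexp (s * X \<omega>) \<partial>N)"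
          by (simp add: char_def integral_distr)
        also have "\<dots> = (\<integral>\<omega>. (u \<omega> / \<kappa>) *\<^sub>R iexp (s * X \<omega>) \<partial>M)"
          unfolding N_def by (rule integral_density) (use nn' in auto)
        also have "\<dots> = (\<integral>\<omega>. (complex_of_real (u \<omega>) * iexp (s * X \<omega>)) / complex_of_real \<kappa> \<partial>M)"
          by (intro Bochner_Integration.integral_cong) (auto simp: scaleR_conv_of_real)
        also have "\<dots> = (\<integral>\<omega>. iexp (s * X \<omega>) \<partial>M)"
          using char[of s] False by simp
        finally show "char (distr N borel X) s = char (distr M borel X) s"
          by (simp add: char_def integral_distr)
      qed
    qed
    then have "measure N (X -` B \<inter> space N) = measure M (X -` B \<inter> space M)"
      using B by (metis \<open>X \<in> borel_measurable N\<close> X measure_distr)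
    moreover have "measure N (X -` B \<inter> space N) = (\<integral>\<omega>. (indicator B (X \<omega>) :: real) \<partial>N)"
    proof -
      have "(\<integral>\<omega>. (indicator B (X \<omega>) :: real) \<partial>N) = (\<integral>\<omega>. (indicator (X -` B \<inter> space N) \<omega> :: real) \<partial>N)"
        by (intro Bochner_Integration.integral_cong) (auto simp: indicator_def)
      then show ?thesis by (simp add: Int_assoc)
    qed
    moreover have "(\<integral>\<omega>. (indicator B (X \<omega>) :: real) \<partial>N) = (\<integral>\<omega>. (u \<omega> / \<kappa>) *\<^sub>R indicator B (X \<omega>) \<partial>M)"
      unfolding N_def by (rule integral_density) (use nn' B in auto)
    moreover have "\<dots> = (\<integral>\<omega>. u \<omega> * indicator B (X \<omega>) \<partial>M) / \<kappa>"
      by simp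
    ultimately show ?thesis using False by (simp add: field_simps)
  qed
qed

context prob_space
begin

text \<open>The weight \<open>w\<close> is what makes the induction on \<open>I\<close> possible:
  the indicator of \<open>X j\<close> in \<open>B j\<close> is moved into the weight, and the work
  lies in showing that the factorization hypothesis survives this change of weight for the remaining
  coordinates.\<close>

lemma integral_indicator_eq_prod_of_char_factorization:
  fixes X :: "'i \<Rightarrow> 'a \<Rightarrow> real" and w :: "'a \<Rightarrow> real"
  assumes "finite I"
    and X: "\<And>i. i \<in> I \<Longrightarrow> X i \<in> borel_measurable M"
    and B: "\<And>i. i \<in> I \<Longrightarrow> B i \<in> sets borel"
    and w: "w \<in> borel_measurable M"
    and nn: "\<And>\<omega>. \<omega> \<in> space M \<Longrightarrow> 0 \<le> w \<omega>" and bd: "\<And>\<omega>. \<omega> \<in> space M \<Longrightarrow> w \<omega> \<le> K"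
    and char: "\<And>c. (\<integral>\<omega>. complex_of_real (w \<omega>) * iexp (\<Sum>i\<in>I. c i * X i \<omega>) \<partial>M)
       = complex_of_real (\<integral>\<omega>. w \<omega> \<partial>M) * (\<Prod>i\<in>I. \<integral>\<omega>. iexp (c i * X i \<omega>) \<partial>M)"
  shows "(\<integral>\<omega>. w \<omega> * (\<Prod>i\<in>I. indicator (B i) (X i \<omega>)) \<partial>M)
    = (\<integral>\<omega>. w \<omega> \<partial>M) * (\<Prod>i\<in>I. prob (X i -` B i \<inter> space M))"
  using assms
proof (induction I arbitrary: w K rule: finite_induct)
  case empty
  then show ?case by simp
next
  case (insert j I)
  note w[measurable] = insert.prems(3) and nn = insert.prems(4) and bd = insert.prems(5)
  note char = insert.prems(6)
  have Xj[measurable]: "X j \<in> borel_measurable M" and XI: "\<And>i. i \<in> I \<Longrightarrow> X i \<in> borel_measurable M"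
    and Bj[measurable]: "B j \<in> sets borel"
    using insert.prems by auto
  define L where "L c \<omega> = (\<Sum>i\<in>I. c i * X i \<omega>)" for c \<omega>
  have L[measurable]: "L c \<in> borel_measurable M" for c
    unfolding L_def using XI by measurable
  define \<phi> where "\<phi> i s = (\<integral>\<omega>. iexp (s * X i \<omega>) \<partial>M)" for i and s :: real
  define \<Phi> where "\<Phi> c = (\<Prod>i\<in>I. \<phi> i (c i))" for c
  have K: "\<bar>w \<omega>\<bar> \<le> \<bar>K\<bar>" if "\<omega> \<in> space M" for \<omega>
    using nn[OF that] bd[OF that] by linarith
  have \<phi>_uminus: "\<phi> i (- s) = cnj (\<phi> i s)" for i s
    unfolding \<phi>_def by (subst Bochner_Integration.integral_cnj[symmetric]) (simp add: exp_cnj)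
  have \<Phi>_uminus: "\<Phi> (\<lambda>i. - c i) = cnj (\<Phi> c)" for c
    unfolding \<Phi>_def by (simp add: \<phi>_uminus)
  have joint: "(\<integral>\<omega>. complex_of_real (w \<omega>) * iexp (s * X j \<omega> + L c \<omega>) \<partial>M)
      = complex_of_real (\<integral>\<omega>. w \<omega> \<partial>M) * (\<phi> j s * \<Phi> c)" for s c
  proof -
    have "(\<Sum>i\<in>insert j I. (c(j := s)) i * X i \<omega>) = s * X j \<omega> + L c \<omega>" for \<omega>
      using insert.hyps by (simp add: L_def) (intro sum.cong, auto)
    moreover have "(\<Prod>i\<in>insert j I. \<phi> i ((c(j := s)) i)) = \<phi> j s * \<Phi> c"
      using insert.hyps by (simp add: \<Phi>_def) (intro disjI2 prod.cong, auto)
    ultimately show ?thesis using char[of "c(j := s)"] unfolding \<phi>_def by simp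
  qed
  have int_e: "integrable M (\<lambda>\<omega>. complex_of_real (w \<omega>) * iexp (s * X j \<omega> + L c \<omega>))" for s c
    by (rule integrable_const_bound[of _ "\<bar>K\<bar>"]) (use K in \<open>auto simp: norm_mult\<close>)
  have int_wB: "integrable M (\<lambda>\<omega>. w \<omega> * indicator (B j) (X j \<omega>))"
    by (rule integrable_const_bound[of _ "\<bar>K\<bar>"]) (use K in \<open>auto simp: indicator_def\<close>)
  have int_wBe: "integrable M (\<lambda>\<omega>. complex_of_real (w \<omega> * indicator (B j) (X j \<omega>)) * iexp (L c \<omega>))" for c
    by (rule integrable_const_bound[of _ "\<bar>K\<bar>"]) (use K in \<open>auto simp: indicator_def norm_mult\<close>)
  \<comment> \<open>With all other frequencies zero, the hypothesis says that weighting by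
    \<open>w\<close> only rescales the law of \<open>X j\<close>.\<close>
  have wB: "(\<integral>\<omega>. w \<omega> * indicator (B j) (X j \<omega>) \<partial>M)
      = (\<integral>\<omega>. w \<omega> \<partial>M) * prob (X j -` B j \<inter> space M)"
  proof (rule weighted_char_determines[of M _ _ K])
    fix s show "(\<integral>\<omega>. complex_of_real (w \<omega>) * iexp (s * X j \<omega>) \<partial>M)
        = complex_of_real (\<integral>\<omega>. w \<omega> \<partial>M) * (\<integral>\<omega>. iexp (s * X j \<omega>) \<partial>M)"
      using joint[of s "\<lambda>_. 0"] by (simp add: L_def \<Phi>_def \<phi>_def prob_space)
  qed (use nn bd prob_space_axioms in auto)
  \<comment> \<open>The weight \<open>w (1 + Re (z e\<^sup>i\<^sup>L))\<close> is nonnegative, so uniqueness for one-dimensional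
    characteristic functions applies under it.\<close>
  have Re_part: "(\<integral>\<omega>. w \<omega> * Re (z * iexp (L c \<omega>)) * indicator (B j) (X j \<omega>) \<partial>M)
      = (\<integral>\<omega>. w \<omega> \<partial>M) * prob (X j -` B j \<inter> space M) * Re (z * \<Phi> c)"
    if z: "norm z = 1" for z c
  proof -
    have Re1: "\<bar>Re (z * iexp (L c \<omega>))\<bar> \<le> 1" for \<omega>
      using abs_Re_le_cmod[of "z * iexp (L c \<omega>)"] z by (simp add: norm_mult)
    define u where "u \<omega> = w \<omega> * (1 + Re (z * iexp (L c \<omega>)))" for \<omega>
    have [measurable]: "u \<in> borel_measurable M" unfolding u_def by measurable
    have int_wRe: "integrable M (\<lambda>\<omega>. w \<omega> * Re (z * iexp (L c \<omega>)) * indicator (B j) (X j \<omega>))"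
    proof (rule integrable_const_bound[of _ "\<bar>K\<bar>"])
      show "AE \<omega> in M. norm (w \<omega> * Re (z * iexp (L c \<omega>)) * indicator (B j) (X j \<omega>)) \<le> \<bar>K\<bar>"
      proof (rule AE_I2)
        fix \<omega> assume "\<omega> \<in> space M"
        then have "\<bar>w \<omega>\<bar> * \<bar>Re (z * iexp (L c \<omega>))\<bar> \<le> \<bar>K\<bar> * 1"
          by (intro mult_mono K Re1) auto
        then show "norm (w \<omega> * Re (z * iexp (L c \<omega>)) * indicator (B j) (X j \<omega>)) \<le> \<bar>K\<bar>"
          by (auto simp: indicator_def abs_mult)
      qed
    qed measurable
    have "(\<integral>\<omega>. u \<omega> * indicator (B j) (X j \<omega>) \<partial>M)
        = ((\<integral>\<omega>. w \<omega> \<partial>M) * (1 + Re (z * \<Phi> c))) * prob (X j -` B j \<inter> space M)"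
    proof (rule weighted_char_determines[of M _ _ "2 * \<bar>K\<bar>"])
      fix \<omega> assume \<omega>: "\<omega> \<in> space M"
      show "0 \<le> u \<omega>" unfolding u_def using nn[OF \<omega>] Re1[of \<omega>] by (intro mult_nonneg_nonneg) auto
      have "w \<omega> * (1 + Re (z * iexp (L c \<omega>))) \<le> \<bar>K\<bar> * 2"
        using nn[OF \<omega>] K[OF \<omega>] Re1[of \<omega>] by (intro mult_mono) auto
      then show "u \<omega> \<le> 2 * \<bar>K\<bar>" by (simp add: u_def mult.commute)
    next
      fix s
      \<comment> \<open>Writing Re y = (y + cnj y) / 2 splits the weighted exponential into three
        with frequency vectors 0, c and -c on \<open>I\<close>, each of which is covered by
        \<open>joint\<close>.\<close>
      have ue: "complex_of_real (u \<omega>) * iexp (s * X j \<omega>)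
          = complex_of_real (w \<omega>) * iexp (s * X j \<omega> + L (\<lambda>_. 0) \<omega>)
            + (z / 2) * (complex_of_real (w \<omega>) * iexp (s * X j \<omega> + L c \<omega>))
            + (cnj z / 2) * (complex_of_real (w \<omega>) * iexp (s * X j \<omega> + L (\<lambda>i. - c i) \<omega>))" for \<omega>
      proof -
        define y where "y = z * iexp (L c \<omega>)"
        have "complex_of_real (Re y) = (y + cnj y) / 2"
          by (simp add: complex_eq_iff)
        then have "complex_of_real (u \<omega>) = complex_of_real (w \<omega>) * (1 + (y + cnj y) / 2)"
          by (simp add: u_def y_def del: of_real_add flip: y_def) (simp add: y_def)
        moreover have "cnj y = cnj z * iexp (- L c \<omega>)"
          by (simp add: y_def exp_cnj)
        moreover have "L (\<lambda>_. 0) \<omega> = 0" "L (\<lambda>i. - c i) \<omega> = - L c \<omega>"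
          by (simp_all add: L_def sum_negf)
        moreover have "iexp (a + b) = iexp a * iexp b" for a b :: real
          by (simp add: distrib_left exp_add)
        ultimately show ?thesis
          unfolding y_def by (simp only: of_real_0 add_0_right) (simp add: field_simps)
      qed
      have "(\<integral>\<omega>. complex_of_real (u \<omega>) * iexp (s * X j \<omega>) \<partial>M)
          = complex_of_real (\<integral>\<omega>. w \<omega> \<partial>M) * (\<phi> j s * \<Phi> (\<lambda>_. 0))
            + (z / 2) * (complex_of_real (\<integral>\<omega>. w \<omega> \<partial>M) * (\<phi> j s * \<Phi> c))
            + (cnj z / 2) * (complex_of_real (\<integral>\<omega>. w \<omega> \<partial>M) * (\<phi> j s * \<Phi> (\<lambda>i. - c i)))"
        unfolding ue by (simp only: Bochner_Integration.integral_add Bochner_Integration.integrable_add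
          integrable_mult_right int_e integral_mult_right_zero joint)
      also have "\<Phi> (\<lambda>_. 0) = 1" by (simp add: \<Phi>_def \<phi>_def prob_space)
      also have "complex_of_real (\<integral>\<omega>. w \<omega> \<partial>M) * (\<phi> j s * 1)
            + (z / 2) * (complex_of_real (\<integral>\<omega>. w \<omega> \<partial>M) * (\<phi> j s * \<Phi> c))
            + (cnj z / 2) * (complex_of_real (\<integral>\<omega>. w \<omega> \<partial>M) * (\<phi> j s * \<Phi> (\<lambda>i. - c i)))
          = complex_of_real (\<integral>\<omega>. w \<omega> \<partial>M) * (1 + (z * \<Phi> c + cnj (z * \<Phi> c)) / 2) * \<phi> j s"
        by (simp add: \<Phi>_uminus algebra_simps add_divide_distrib)
      \<comment> \<open>Since \<Phi>(-c) is the conjugate of \<Phi>(c), the terms for c and -c add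
        up to a real number, so the factor in front of \<phi> is the real constant that
        \<open>weighted_char_determines\<close> requires.\<close>
      also have "(z * \<Phi> c + cnj (z * \<Phi> c)) / 2 = complex_of_real (Re (z * \<Phi> c))"
        by (subst complex_add_cnj) simp
      finally show "(\<integral>\<omega>. complex_of_real (u \<omega>) * iexp (s * X j \<omega>) \<partial>M)
          = complex_of_real ((\<integral>\<omega>. w \<omega> \<partial>M) * (1 + Re (z * \<Phi> c))) * (\<integral>\<omega>. iexp (s * X j \<omega>) \<partial>M)"
        by (simp add: \<phi>_def)
    qed (auto intro: prob_space_axioms)
    moreover have "(\<integral>\<omega>. u \<omega> * indicator (B j) (X j \<omega>) \<partial>M)
        = (\<integral>\<omega>. w \<omega> * indicator (B j) (X j \<omega>) \<partial>M)
          + (\<integral>\<omega>. w \<omega> * Re (z * iexp (L c \<omega>)) * indicator (B j) (X j \<omega>) \<partial>M)"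
      by (subst Bochner_Integration.integral_add[symmetric, OF int_wB int_wRe])
         (simp add: u_def algebra_simps)
    ultimately show ?thesis using wB by (simp add: algebra_simps)
  qed
  have "(\<integral>\<omega>. (w \<omega> * indicator (B j) (X j \<omega>)) * (\<Prod>i\<in>I. indicator (B i) (X i \<omega>)) \<partial>M)
    = (\<integral>\<omega>. w \<omega> * indicator (B j) (X j \<omega>) \<partial>M) * (\<Prod>i\<in>I. prob (X i -` B i \<inter> space M))"
  \<comment> \<open>The new weight is \<open>w\<close> times the indicator. Its factorization comes
    from \<open>Re_part\<close> at z = 1 for the real part and at z = -i for the imaginary
    part.\<close>
  proof (rule insert.IH[of _ "\<bar>K\<bar>"])
    fix c
    let ?J = "\<integral>\<omega>. complex_of_real (w \<omega> * indicator (B j) (X j \<omega>)) * iexp (L c \<omega>) \<partial>M"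
    have "Re ?J = (\<integral>\<omega>. w \<omega> * Re (1 * iexp (L c \<omega>)) * indicator (B j) (X j \<omega>) \<partial>M)"
      by (subst integral_Re[OF int_wBe, symmetric]) (simp add: mult_ac)
    \<comment> \<open>Im y = Re (-i y).\<close>
    moreover have "Im ?J = (\<integral>\<omega>. w \<omega> * Re (- \<i> * iexp (L c \<omega>)) * indicator (B j) (X j \<omega>) \<partial>M)"
      by (subst integral_Im[OF int_wBe, symmetric]) (simp add: mult_ac)
    ultimately have "?J = complex_of_real ((\<integral>\<omega>. w \<omega> \<partial>M) * prob (X j -` B j \<inter> space M)) * \<Phi> c"
      using Re_part[of 1 c] Re_part[of "- \<i>" c] by (simp add: complex_eq_iff)
    then show "(\<integral>\<omega>. complex_of_real (w \<omega> * indicator (B j) (X j \<omega>)) * iexp (\<Sum>i\<in>I. c i * X i \<omega>) \<partial>M)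
       = complex_of_real (\<integral>\<omega>. w \<omega> * indicator (B j) (X j \<omega>) \<partial>M)
          * (\<Prod>i\<in>I. \<integral>\<omega>. iexp (c i * X i \<omega>) \<partial>M)"
      by (simp add: wB L_def \<Phi>_def \<phi>_def)
  next
    fix \<omega> assume "\<omega> \<in> space M"
    then show "0 \<le> w \<omega> * indicator (B j) (X j \<omega>)" "w \<omega> * indicator (B j) (X j \<omega>) \<le> \<bar>K\<bar>"
      using nn K by (auto simp: indicator_def)
  qed (use insert.prems in auto)
  then show ?case
    using insert.hyps wB by (simp add: mult_ac)
qed

text \<open>This is the preceding lemma with constant weight 1: the probability of an intersection
  is the integral of a product of indicators.\<close>

lemma indep_vars_of_char_factorization:
  fixes X :: "'i \<Rightarrow> 'a \<Rightarrow> real"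
  assumes "finite I" and "I \<noteq> {}"
    and X: "\<And>i. i \<in> I \<Longrightarrow> X i \<in> borel_measurable M"
    and char: "\<And>c. (\<integral>\<omega>. iexp (\<Sum>i\<in>I. c i * X i \<omega>) \<partial>M) = (\<Prod>i\<in>I. \<integral>\<omega>. iexp (c i * X i \<omega>) \<partial>M)"
  shows "indep_vars (\<lambda>_. borel) X I"
proof (subst indep_vars_finite[where E="\<lambda>_. sets borel"])
  have "prob (\<Inter>j\<in>I. X j -` A j \<inter> space M) = (\<Prod>j\<in>I. prob (X j -` A j \<inter> space M))"
    if A: "A \<in> (\<Pi> i\<in>I. sets borel)" for A
  proof -
  have "prob (\<Inter>j\<in>I. X j -` A j \<inter> space M) = (\<integral>\<omega>. indicator (\<Inter>j\<in>I. X j -` A j \<inter> space M) \<omega> \<partial>M)"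
    using \<open>I \<noteq> {}\<close> by (simp add: Int_absorb2 INF_lower2)
  also have "\<dots> = (\<integral>\<omega>. 1 * (\<Prod>i\<in>I. indicator (A i) (X i \<omega>)) \<partial>M)"
    using \<open>I \<noteq> {}\<close> \<open>finite I\<close>
    by (intro Bochner_Integration.integral_cong) (auto simp: indicator_def prod_zero_iff)
  also have "\<dots> = (\<Prod>j\<in>I. prob (X j -` A j \<inter> space M))"
    by (subst integral_indicator_eq_prod_of_char_factorization[OF \<open>finite I\<close> X, where K=1])
       (use A in \<open>auto simp: char prob_space simp del: of_real_sum of_real_mult\<close>)
  finally show ?thesis .
  qed
  then show "\<forall>A\<in>\<Pi> i\<in>I. sets borel. prob (\<Inter>j\<in>I. X j -` A j \<inter> space M) = (\<Prod>j\<in>I. prob (X j -` A j \<inter> space M))"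
    by blast
qed (use assms in \<open>auto simp: sets.sigma_sets_eq[of borel, simplified] intro: sets.Int_stable\<close>)

end

section \<open>Innovations of a Brownian bridge\<close>

context prob_space
begin

text \<open>The point mass has no density and is treated apart: there \<open>X\<close> is almost
  surely constant. It does occur, for instance as the combination with all coefficients zero. The
  characteristic function is taken after centering, which makes its value real.\<close>

lemma normal_lawD:
  assumes "normal_law M X m v"
  shows normal_law_measurable: "X \<in> borel_measurable M"
    and normal_law_integrable: "integrable M X"
    and normal_law_expectation: "expectation X = m"
    and normal_law_integrable_square: "integrable M (\<lambda>\<omega>. (X \<omega>)\<^sup>2)"
    and normal_law_variance: "variance X = v"
    and normal_law_char: "(\<integral>\<omega>. iexp (X \<omega> - m) \<partial>M) = exp (- v / 2)"
proof -
  have X[measurable]: "X \<in> borel_measurable M" and v: "0 \<le> v"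
    and law: "distr M borel X = (if v = 0 then return borel m else density lborel (normal_density m (sqrt v)))"
    using assms by (auto simp: normal_law_def)
  show "X \<in> borel_measurable M" by fact
  have "integrable M X \<and> expectation X = m \<and> integrable M (\<lambda>\<omega>. (X \<omega>)\<^sup>2) \<and> variance X = v \<and>
    (\<integral>\<omega>. iexp (X \<omega> - m) \<partial>M) = exp (- v / 2)"
  proof (cases "v = 0")
    case True
    have "AE x in return borel m. x = m"
      by (simp add: AE_return)
    then have "AE x in distr M borel X. x = m"
      using law True by metis
    then have ae: "AE \<omega> in M. X \<omega> = m"
      by (subst (asm) AE_distr_iff) auto
    have e: "expectation X = m"
      using integral_cong_AE[of X M "\<lambda>_. m"] ae by (auto simp: prob_space)
    have "integrable M X"
      using integrable_cong_AE[of X M "\<lambda>_. m"] ae by auto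
    moreover have "integrable M (\<lambda>\<omega>. (X \<omega>)\<^sup>2)"
    proof -
      have "AE \<omega> in M. (X \<omega>)\<^sup>2 = m\<^sup>2" using ae by eventually_elim simp
      then show ?thesis
        using integrable_cong_AE[of "\<lambda>\<omega>. (X \<omega>)\<^sup>2" M "\<lambda>_. m\<^sup>2"] by auto
    qed
    moreover have "variance X = (\<integral>\<omega>. 0 \<partial>M)"
      unfolding e by (rule integral_cong_AE) (use ae in auto)
    moreover have "(\<integral>\<omega>. iexp (X \<omega> - m) \<partial>M) = (\<integral>\<omega>. 1 \<partial>M)"
      by (rule integral_cong_AE) (use ae in auto)
    ultimately show ?thesis using True e by (simp add: prob_space)
  next
    case False
    then have \<sigma>: "0 < sqrt v" using v by simp
    have D: "distributed M lborel X (normal_density m (sqrt v))"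
      using law False by (auto simp: distributed_def cong: distr_cong)
    have e: "expectation X = m" by (rule normal_distributed_expectation[OF \<sigma> D])
    have int1: "integrable M X"
      using distributed_integrable[OF D, of "\<lambda>x. x"] integrable_normal_moment_nz_1[OF \<sigma>, of m]
      by simp
    have "integrable M (\<lambda>\<omega>. (X \<omega> - m)\<^sup>2)"
      using distributed_integrable[OF D, of "\<lambda>x. (x - m)\<^sup>2"] integrable_normal_moment[OF \<sigma>, of m 2]
      by simp
    then have "integrable M (\<lambda>\<omega>. (X \<omega> - m)\<^sup>2 + 2 * m * X \<omega> - m\<^sup>2)"
      using int1 by auto
    moreover have "(\<lambda>\<omega>. (X \<omega> - m)\<^sup>2 + 2 * m * X \<omega> - m\<^sup>2) = (\<lambda>\<omega>. (X \<omega>)\<^sup>2)"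
      by (auto simp: power2_eq_square algebra_simps)
    ultimately have int2: "integrable M (\<lambda>\<omega>. (X \<omega>)\<^sup>2)" by simp
    have var: "variance X = v"
      using normal_distributed_variance[OF \<sigma> D] v by simp
    define Y where "Y \<omega> = (X \<omega> - m) / sqrt v" for \<omega>
    have "distributed M lborel Y std_normal_density"
      using D unfolding normal_standard_normal_convert[OF \<sigma>] Y_def .
    then have Y: "distr M borel Y = std_normal_distribution"
      by (auto simp: distributed_def cong: distr_cong)
    have [measurable]: "Y \<in> borel_measurable M" unfolding Y_def by simp
    have "(\<integral>\<omega>. iexp (X \<omega> - m) \<partial>M) = (\<integral>\<omega>. iexp (sqrt v * Y \<omega>) \<partial>M)"
      using \<sigma> by (simp add: Y_def)
    also have "\<dots> = char (distr M borel Y) (sqrt v)"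
      by (simp add: char_def integral_distr)
    also have "\<dots> = exp (- v / 2)"
      unfolding Y char_std_normal_distribution using v by (simp add: exp_of_real)
    finally show ?thesis using e int1 int2 var by simp
  qed
  then show "integrable M X" "expectation X = m" "integrable M (\<lambda>\<omega>. (X \<omega>)\<^sup>2)" "variance X = v"
    "(\<integral>\<omega>. iexp (X \<omega> - m) \<partial>M) = exp (- v / 2)" by auto
qed

lemma integrable_mult_of_squares:
  fixes X Y :: "'a \<Rightarrow> real"
  assumes [measurable]: "X \<in> borel_measurable M" "Y \<in> borel_measurable M"
    and "integrable M (\<lambda>\<omega>. (X \<omega>)\<^sup>2)" "integrable M (\<lambda>\<omega>. (Y \<omega>)\<^sup>2)"
  shows "integrable M (\<lambda>\<omega>. X \<omega> * Y \<omega>)"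
proof (rule Bochner_Integration.integrable_bound[of M "\<lambda>\<omega>. (X \<omega>)\<^sup>2 + (Y \<omega>)\<^sup>2"])
  have "\<bar>x * y\<bar> \<le> x\<^sup>2 + y\<^sup>2" for x y :: real
  proof -
    have "0 \<le> (\<bar>x\<bar> - \<bar>y\<bar>)\<^sup>2" by simp
    then have "2 * (\<bar>x\<bar> * \<bar>y\<bar>) \<le> x\<^sup>2 + y\<^sup>2" by (simp add: power2_diff)
    moreover have "0 \<le> \<bar>x\<bar> * \<bar>y\<bar>" by simp
    ultimately show ?thesis unfolding abs_mult by linarith
  qed
  then show "AE \<omega> in M. norm (X \<omega> * Y \<omega>) \<le> norm ((X \<omega>)\<^sup>2 + (Y \<omega>)\<^sup>2)"
    by simp
qed (use assms in auto)

text \<open>A normal law is determined by mean and variance. For a linear combination the mean is 0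
  and the cross terms of the variance vanish, so the exponent of the characteristic function is a
  sum over \<open>I\<close> and the exponential is a product.\<close>

lemma gaussian_uncorrelated_indep:
  fixes D :: "'i \<Rightarrow> 'a \<Rightarrow> real"
  assumes "finite I" and "I \<noteq> {}"
    and gauss: "\<And>c. \<exists>m v. normal_law M (\<lambda>\<omega>. \<Sum>i\<in>I. c i * D i \<omega>) m v"
    and centered: "\<And>i. i \<in> I \<Longrightarrow> expectation (D i) = 0"
    and cov: "\<And>i j. i \<in> I \<Longrightarrow> j \<in> I \<Longrightarrow> expectation (\<lambda>\<omega>. D i \<omega> * D j \<omega>) = (if i = j then r i else 0)"
  shows "indep_vars (\<lambda>_. borel) D I"
    and "i \<in> I \<Longrightarrow> normal_law M (D i) 0 (r i)"
proof -
  have single: "\<exists>m v. normal_law M (D i) m v" if "i \<in> I" for i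
  proof -
    have "(\<Sum>j\<in>I. of_bool (j = i) * D j \<omega>) = D i \<omega>" for \<omega>
      using that \<open>finite I\<close> by (simp add: if_distrib if_distribR of_bool_def cong: if_cong)
    then show ?thesis using gauss[of "\<lambda>j. of_bool (j = i)"] by simp
  qed
  have D[measurable]: "D i \<in> borel_measurable M" and int1: "integrable M (D i)"
    and int2: "integrable M (\<lambda>\<omega>. (D i \<omega>)\<^sup>2)" if "i \<in> I" for i
    using single[OF that] normal_lawD by blast+
  have int11: "integrable M (\<lambda>\<omega>. D i \<omega> * D j \<omega>)" if "i \<in> I" "j \<in> I" for i j
    using integrable_mult_of_squares D int2 that by blast
  have law: "normal_law M (\<lambda>\<omega>. \<Sum>i\<in>I. c i * D i \<omega>) 0 (\<Sum>i\<in>I. (c i)\<^sup>2 * r i)" for c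
  proof -
    obtain m v where n: "normal_law M (\<lambda>\<omega>. \<Sum>i\<in>I. c i * D i \<omega>) m v" using gauss by blast
    have m: "m = 0"
      unfolding normal_law_expectation[OF n, symmetric]
      by (subst Bochner_Integration.integral_sum) (use int1 centered in auto)
    have "v = expectation (\<lambda>\<omega>. (\<Sum>i\<in>I. c i * D i \<omega>)\<^sup>2)"
      using normal_law_variance[OF n] normal_law_expectation[OF n] m by simp
    also have "\<dots> = expectation (\<lambda>\<omega>. \<Sum>i\<in>I. \<Sum>j\<in>I. c i * c j * (D i \<omega> * D j \<omega>))"
      by (simp add: power2_eq_square sum_product mult_ac)
    also have "\<dots> = (\<Sum>i\<in>I. \<Sum>j\<in>I. c i * c j * (if i = j then r i else 0))"
      by (simp add: Bochner_Integration.integral_sum int11 cov cong: sum.cong)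
    also have "\<dots> = (\<Sum>i\<in>I. (c i)\<^sup>2 * r i)"
      using \<open>finite I\<close> by (simp add: power2_eq_square if_distrib cong: if_cong)
    finally show ?thesis using n m by simp
  qed
  have char: "(\<integral>\<omega>. iexp (\<Sum>i\<in>I. c i * D i \<omega>) \<partial>M) = (\<Prod>i\<in>I. complex_of_real (exp (- ((c i)\<^sup>2 * r i) / 2)))" for c
  proof -
    have "- (\<Sum>i\<in>I. (c i)\<^sup>2 * r i) / 2 = (\<Sum>i\<in>I. - ((c i)\<^sup>2 * r i) / 2)"
      by (simp add: sum_negf sum_divide_distrib)
    then show ?thesis
      using normal_law_char[OF law[of c]] by (simp only: exp_sum[OF \<open>finite I\<close>] of_real_prod diff_0_right)
  qed
  have scaled: "normal_law M (\<lambda>\<omega>. s * D i \<omega>) 0 (s\<^sup>2 * r i)" if "i \<in> I" for s i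
  proof -
    have "(\<Sum>j\<in>I. (if j = i then s else 0) * D j \<omega>) = s * D i \<omega>" for \<omega>
      using that \<open>finite I\<close> by (simp add: if_distrib if_distribR cong: if_cong)
    moreover have "(\<Sum>j\<in>I. (if j = i then s else 0)\<^sup>2 * r j) = s\<^sup>2 * r i"
      using that \<open>finite I\<close> by (simp add: if_distrib if_distribR cong: if_cong)
    ultimately show ?thesis using law[of "\<lambda>j. if j = i then s else 0"] by simp
  qed
  show "normal_law M (D i) 0 (r i)" if "i \<in> I" using scaled[OF that, of 1] by simp
  show "indep_vars (\<lambda>_. borel) D I"
  proof (rule indep_vars_of_char_factorization[OF \<open>finite I\<close> \<open>I \<noteq> {}\<close> D])
    fix c
    have "(\<Prod>i\<in>I. \<integral>\<omega>. iexp (c i * D i \<omega>) \<partial>M) = (\<Prod>i\<in>I. complex_of_real (exp (- ((c i)\<^sup>2 * r i) / 2)))"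
      using normal_law_char[OF scaled] by (intro prod.cong) simp_all
    then show "(\<integral>\<omega>. iexp (\<Sum>i\<in>I. c i * D i \<omega>) \<partial>M) = (\<Prod>i\<in>I. \<integral>\<omega>. iexp (c i * D i \<omega>) \<partial>M)"
      by (simp only: char)
  qed
qed

end

text \<open>\<tau> may take the same time more than once, in which case coefficients at equal times
  are added. Innovations need this, because consecutive ones share a value of the bridge.\<close>

lemma gaussian_process_reindex:
  assumes "gaussian_process M I X" and "finite K" and \<tau>: "\<And>k. k \<in> K \<Longrightarrow> \<tau> k \<in> I"
  shows "\<exists>m v. normal_law M (\<lambda>\<omega>. \<Sum>k\<in>K. c k * X (\<tau> k) \<omega>) m v"
proof -
  have "(\<Sum>k\<in>K. c k * X (\<tau> k) \<omega>) = (\<Sum>t\<in>\<tau> ` K. (\<Sum>k | k \<in> K \<and> \<tau> k = t. c k) * X t \<omega>)" for \<omega>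
    by (subst sum.image_gen[OF \<open>finite K\<close>, where g=\<tau>]) (auto simp: sum_distrib_right intro!: sum.cong)
  then show ?thesis
    using assms unfolding gaussian_process_def by (simp add: image_subset_iff)
qed

text \<open>For t >= 2 this is the regression coefficient of \<open>B t\<close> on
  \<open>B (t - 1)\<close>: the covariance (t - 1)(T - t) / T divided by the variance (t - 1)(T - t
  + 1) / T.\<close>

definition innovation_coeff :: "nat \<Rightarrow> nat \<Rightarrow> real" where
  "innovation_coeff T t = (if t \<le> 1 then 0 else (real T - real t) / (real T - real t + 1))"

text \<open>The variance left after the regression on the previous time. At t = 1, where nothing is
  subtracted, the same formula gives (T - 1) / T, the variance of \<open>B 1\<close>.\<close>

definition innovation_var :: "nat \<Rightarrow> nat \<Rightarrow> real" where
  "innovation_var T t = (real T - real t) / (real T - real t + 1)"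

text \<open>For s < t the covariance s (T - t) / T is proportional to T - t in the later time.
  Subtracting the multiple by the ratio (T - t) / (T - t + 1) therefore removes the correlation with
  all earlier times at once, not only with time t - 1.\<close>

lemma (in prob_space) bridge_innovations:
  fixes B :: "real \<Rightarrow> 'a \<Rightarrow> real"
  assumes B: "brownian_bridge M (real T) B" and T: "2 \<le> T"
  defines "D \<equiv> \<lambda>t \<omega>. B (real t) \<omega> - innovation_coeff T t * B (real (t - 1)) \<omega>"
  shows "indep_vars (\<lambda>_. borel) D {1..T - 1}"
    and "t \<in> {1..T - 1} \<Longrightarrow> normal_law M (D t) 0 (innovation_var T t)"
proof -
  have gp: "gaussian_process M {0..real T} B"
    and law: "\<And>t. t \<in> {0..real T} \<Longrightarrow> normal_law M (B t) 0 (t * (real T - t) / real T)"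
    and cov: "\<And>s t. s \<in> {0..real T} \<Longrightarrow> t \<in> {0..real T} \<Longrightarrow> s < t \<Longrightarrow>
      covariance M (B s) (B t) = s * (real T - t) / real T"
    using B by (auto simp: brownian_bridge_def)
  define b where "b n = B (real n)" for n :: nat
  have law': "normal_law M (b n) 0 (real n * (real T - real n) / real T)" if "n \<le> T" for n
    unfolding b_def by (rule law) (use that in auto)
  have b[measurable]: "b n \<in> borel_measurable M" and b1: "integrable M (b n)" "expectation (b n) = 0"
    and b2: "integrable M (\<lambda>\<omega>. (b n \<omega>)\<^sup>2)" if "n \<le> T" for n
    using normal_lawD[OF law'[OF that]] by auto
  have b11: "integrable M (\<lambda>\<omega>. b n \<omega> * b k \<omega>)" if "n \<le> T" "k \<le> T" for n k
    using integrable_mult_of_squares b b2 that by blast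
  \<comment> \<open>The covariance formula is given for strictly ordered times. On the diagonal it
    is supplied by the variance of the one-dimensional law.\<close>
  have K: "expectation (\<lambda>\<omega>. b n \<omega> * b k \<omega>) = real n * (real T - real k) / real T"
    if "n \<le> k" "k \<le> T" for n k
  proof (cases "n = k")
    case True
    then show ?thesis
      using normal_law_variance[OF law'[of k]] b1[of k] that by (simp add: power2_eq_square)
  next
    case False
    then show ?thesis
      using cov[of "real n" "real k"] b1[of n] b1[of k] that by (simp add: covariance_def b_def)
  qed
  define \<rho> where "\<rho> = innovation_coeff T"
  have D: "D t \<omega> = b t \<omega> - \<rho> t * b (t - 1) \<omega>" for t \<omega>
    by (simp add: D_def b_def \<rho>_def)
  have DD: "expectation (\<lambda>\<omega>. D s \<omega> * D t \<omega>) = (if s = t then innovation_var T s else 0)"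
    if st: "s \<in> {1..T - 1}" "t \<in> {1..T - 1}" "s \<le> t" for s t
  proof -
    have le: "s \<le> T" "t \<le> T" "s - 1 \<le> T" "t - 1 \<le> T" using st by auto
    have "expectation (\<lambda>\<omega>. D s \<omega> * D t \<omega>) = expectation (\<lambda>\<omega>. b s \<omega> * b t \<omega> - \<rho> t * (b s \<omega> * b (t - 1) \<omega>)
        - \<rho> s * (b (s - 1) \<omega> * b t \<omega>) + \<rho> s * \<rho> t * (b (s - 1) \<omega> * b (t - 1) \<omega>))"
      by (simp add: D algebra_simps)
    also have "\<dots> = expectation (\<lambda>\<omega>. b s \<omega> * b t \<omega>) - \<rho> t * expectation (\<lambda>\<omega>. b s \<omega> * b (t - 1) \<omega>)
        - \<rho> s * expectation (\<lambda>\<omega>. b (s - 1) \<omega> * b t \<omega>) + \<rho> s * \<rho> t * expectation (\<lambda>\<omega>. b (s - 1) \<omega> * b (t - 1) \<omega>)"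
      by (simp only: Bochner_Integration.integral_add Bochner_Integration.integral_diff
        Bochner_Integration.integrable_add Bochner_Integration.integrable_diff
        integrable_mult_right integral_mult_right_zero b11[OF le(1) le(2)] b11[OF le(1) le(4)]
        b11[OF le(3) le(2)] b11[OF le(3) le(4)])
    also have "\<dots> = (if s = t then innovation_var T s else 0)"
    proof (cases "s = t")
      case True
      have sym: "expectation (\<lambda>\<omega>. b s \<omega> * b (s - 1) \<omega>) = expectation (\<lambda>\<omega>. b (s - 1) \<omega> * b s \<omega>)"
        by (simp add: mult.commute)
      show ?thesis
      proof (cases "s = 1")
        case True
        then show ?thesis using \<open>s = t\<close> st T K[of 1 1]
          by (simp add: \<rho>_def innovation_coeff_def innovation_var_def)
      next
        case False
        define x where "x = real T - real s"
        have "x \<ge> 1" using st T by (auto simp: x_def)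
        have s: "real s = real T - x" "real (s - 1) = real T - x - 1"
          using st by (auto simp: x_def of_nat_diff)
        have \<rho>s: "\<rho> s = x / (x + 1)" "innovation_var T s = x / (x + 1)"
          using False st by (auto simp: \<rho>_def innovation_coeff_def innovation_var_def x_def)
        have k: "expectation (\<lambda>\<omega>. b s \<omega> * b s \<omega>) = (real T - x) * x / real T"
          "expectation (\<lambda>\<omega>. b (s - 1) \<omega> * b s \<omega>) = (real T - x - 1) * x / real T"
          "expectation (\<lambda>\<omega>. b (s - 1) \<omega> * b (s - 1) \<omega>) = (real T - x - 1) * (x + 1) / real T"
          using K[of s s] K[of "s - 1" s] K[of "s - 1" "s - 1"] le s by simp_all
        show ?thesis
        proof -
          \<comment> \<open>T and x + 1 become atoms \<tau> and y so that clearing denominators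
            leaves them intact; the relation y = x + 1 is used only afterwards.\<close>
          have "\<tau> \<noteq> 0 \<Longrightarrow> y \<noteq> 0 \<Longrightarrow> y = x + 1 \<Longrightarrow>
            (\<tau> - x) * x / \<tau> - x / y * ((\<tau> - x - 1) * x / \<tau>) - x / y * ((\<tau> - x - 1) * x / \<tau>)
              + x / y * (x / y) * ((\<tau> - x - 1) * y / \<tau>) = x / y" for \<tau> y :: real
            by (simp add: divide_simps) (simp add: algebra_simps)
          from this[of "real T" "x + 1"] show ?thesis
            unfolding \<open>s = t\<close>[symmetric] sym k \<rho>s using \<open>x \<ge> 1\<close> T by simp
        qed
      qed
    next
      case False
      then have "s < t" "\<not> t \<le> 1" using st by auto
      define x where "x = real T - real t"
      have "x \<ge> 1" using st T by (auto simp: x_def)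
      have t: "real t = real T - x" "real (t - 1) = real T - x - 1"
        using st by (auto simp: x_def of_nat_diff)
      have \<rho>t: "\<rho> t = x / (x + 1)" using \<open>\<not> t \<le> 1\<close> by (simp add: \<rho>_def innovation_coeff_def x_def)
      \<comment> \<open>Multiplication by \<rho> t carries the covariance with time t - 1 to that
        with time t, for any earlier time n. Applied to n = s and n = s - 1, it cancels the four
        terms in pairs.\<close>
      have "\<rho> t * (real n * (real T - real (t - 1)) / real T) = real n * (real T - real t) / real T" for n
      proof -
        have "real T - real (t - 1) = x + 1" "real T - real t = x" using t by simp_all
        then show ?thesis using \<open>x \<ge> 1\<close> by (simp only: \<rho>t) simp
      qed
      moreover have "\<rho> t * expectation (\<lambda>\<omega>. b s \<omega> * b (t - 1) \<omega>) = \<rho> t * (real s * (real T - real (t - 1)) / real T)"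
        "\<rho> t * expectation (\<lambda>\<omega>. b (s - 1) \<omega> * b (t - 1) \<omega>) = \<rho> t * (real (s - 1) * (real T - real (t - 1)) / real T)"
        "expectation (\<lambda>\<omega>. b s \<omega> * b t \<omega>) = real s * (real T - real t) / real T"
        "expectation (\<lambda>\<omega>. b (s - 1) \<omega> * b t \<omega>) = real (s - 1) * (real T - real t) / real T"
        using K[of s "t - 1"] K[of "s - 1" "t - 1"] K[of s t] K[of "s - 1" t] \<open>s < t\<close> le by simp_all
      ultimately show ?thesis
        using False by (simp only: mult.assoc) simp
    qed
    finally show ?thesis .
  qed
  have cov': "expectation (\<lambda>\<omega>. D s \<omega> * D t \<omega>) = (if s = t then innovation_var T s else 0)"
    if "s \<in> {1..T - 1}" "t \<in> {1..T - 1}" for s t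
    using DD[of s t] DD[of t s] that by (cases "s \<le> t") (auto simp: mult.commute)
  have gauss: "\<exists>m v. normal_law M (\<lambda>\<omega>. \<Sum>t\<in>{1..T - 1}. c t * D t \<omega>) m v" for c
  proof -
    \<comment> \<open>Each innovation contributes two terms: the flag \<open>e\<close> marks the one
      at the previous time, with its coefficient - c t * \<rho> t.\<close>
    define a where "a = (\<lambda>(t, e). if e then - c t * \<rho> t else c t)"
    have "\<exists>m v. normal_law M (\<lambda>\<omega>. \<Sum>k\<in>{1..T - 1} \<times> (UNIV :: bool set). a k *
        B (case k of (t, e) \<Rightarrow> real (if e then t - 1 else t)) \<omega>) m v"
      by (rule gaussian_process_reindex[OF gp]) (auto split: if_splits)
    moreover have "(\<Sum>k\<in>{1..T - 1} \<times> (UNIV :: bool set). a k *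
        B (case k of (t, e) \<Rightarrow> real (if e then t - 1 else t)) \<omega>) = (\<Sum>t\<in>{1..T - 1}. c t * D t \<omega>)" for \<omega>
      unfolding sum.cartesian_product' by (simp add: a_def D b_def UNIV_bool algebra_simps)
    ultimately show ?thesis by simp
  qed
  have centered: "expectation (D t) = 0" if "t \<in> {1..T - 1}" for t
  proof -
    have "t \<le> T" "t - 1 \<le> T" using that by auto
    then show ?thesis unfolding D by (simp add: b1)
  qed
  have ne: "{1..T - 1} \<noteq> {}" using T by auto
  show "indep_vars (\<lambda>_. borel) D {1..T - 1}"
    by (rule gaussian_uncorrelated_indep[OF _ ne gauss centered cov']) auto
  show "t \<in> {1..T - 1} \<Longrightarrow> normal_law M (D t) 0 (innovation_var T t)"
    by (rule gaussian_uncorrelated_indep[OF _ ne gauss centered cov']) auto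
qed

section \<open>Lebesgue measure under shears and linear maps\<close>

lemma density_PiM_lborel:
  fixes g :: "'i \<Rightarrow> 'b::euclidean_space \<Rightarrow> ennreal"
  assumes "finite I" and g: "\<And>i. i \<in> I \<Longrightarrow> g i \<in> borel_measurable borel"
    and prob: "\<And>i. i \<in> I \<Longrightarrow> prob_space (density lborel (g i))"
  shows "PiM I (\<lambda>i. density lborel (g i)) = density (PiM I (\<lambda>_. lborel)) (\<lambda>x. \<Prod>i\<in>I. g i (x i))"
proof -
  \<comment> \<open>Off \<open>I\<close> the function \<open>g\<close> is arbitrary, while the
    product locale asks for a sigma-finite measure at every index; \<open>lborel\<close> fills the
    gap.\<close>
  define N where "N i = (if i \<in> I then density lborel (g i) else lborel)" for i
  interpret L: product_sigma_finite "\<lambda>_::'i. lborel :: 'b measure" ..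
  interpret N: product_sigma_finite N
    unfolding N_def product_sigma_finite_def
    using prob by (auto intro: prob_space_imp_sigma_finite lborel.sigma_finite_measure_axioms)
  have sets_N: "sets (PiM I N) = sets (PiM I (\<lambda>_. lborel))"
    by (rule sets_PiM_cong) (auto simp: N_def)
  have [measurable]: "(\<lambda>x. \<Prod>i\<in>I. g i (x i)) \<in> borel_measurable (PiM I (\<lambda>_. lborel))"
    using g by (intro borel_measurable_prod_ennreal measurable_compose[OF measurable_component_singleton]) auto
  have "density (PiM I (\<lambda>_. lborel)) (\<lambda>x. \<Prod>i\<in>I. g i (x i)) = PiM I N"
  proof (rule N.PiM_eqI[OF \<open>finite I\<close>])
    show "sets (density (PiM I (\<lambda>_. lborel)) (\<lambda>x. \<Prod>i\<in>I. g i (x i))) = sets (PiM I N)"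
      by (simp add: sets_N)
    fix A assume "\<And>i. i \<in> I \<Longrightarrow> A i \<in> sets (N i)"
    then have A: "A i \<in> sets borel" if "i \<in> I" for i using that by (auto simp: N_def split: if_splits)
    have "emeasure (density (PiM I (\<lambda>_. lborel)) (\<lambda>x. \<Prod>i\<in>I. g i (x i))) (Pi\<^sub>E I A)
        = (\<integral>\<^sup>+x. (\<Prod>i\<in>I. g i (x i)) * indicator (Pi\<^sub>E I A) x \<partial>PiM I (\<lambda>_. lborel))"
      using A \<open>finite I\<close> by (intro emeasure_density) (auto intro!: sets_PiM_I_finite)
    also have "\<dots> = (\<integral>\<^sup>+x. (\<Prod>i\<in>I. g i (x i) * indicator (A i) (x i)) \<partial>PiM I (\<lambda>_. lborel))"
    proof (rule nn_integral_cong)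
      fix x :: "'i \<Rightarrow> 'b" assume "x \<in> space (PiM I (\<lambda>_. lborel))"
      then have "indicator (Pi\<^sub>E I A) x = (\<Prod>i\<in>I. indicator (A i) (x i) :: ennreal)"
        using \<open>finite I\<close> by (auto simp: indicator_def space_PiM PiE_iff prod_zero_iff)
      then show "(\<Prod>i\<in>I. g i (x i)) * indicator (Pi\<^sub>E I A) x = (\<Prod>i\<in>I. g i (x i) * indicator (A i) (x i))"
        by (simp add: prod.distrib)
    qed
    also have "\<dots> = (\<Prod>i\<in>I. \<integral>\<^sup>+y. g i y * indicator (A i) y \<partial>lborel)"
      using g A by (intro L.product_nn_integral_prod[OF \<open>finite I\<close>]) auto
    also have "\<dots> = (\<Prod>i\<in>I. emeasure (N i) (A i))"
      using g A by (intro prod.cong) (auto simp: N_def emeasure_density)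
    finally show "emeasure (density (PiM I (\<lambda>_. lborel)) (\<lambda>x. \<Prod>i\<in>I. g i (x i))) (Pi\<^sub>E I A)
      = (\<Prod>i\<in>I. emeasure (N i) (A i))" .
  qed
  also have "PiM I N = PiM I (\<lambda>i. density lborel (g i))"
    by (rule PiM_cong) (auto simp: N_def)
  finally show ?thesis by simp
qed

lemma nn_integral_lborel_translate:
  fixes f :: "'b::euclidean_space \<Rightarrow> ennreal"
  assumes [measurable]: "f \<in> borel_measurable borel"
  shows "(\<integral>\<^sup>+x. f (x + c) \<partial>lborel) = (\<integral>\<^sup>+x. f x \<partial>lborel)"
proof -
  have "(\<integral>\<^sup>+x. f x \<partial>lborel) = (\<integral>\<^sup>+x. f x \<partial>distr lborel borel (\<lambda>x. c + x))"
    using lborel_affine[of 1 c] by (simp add: density_1 one_ennreal_def[symmetric])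
  then show ?thesis by (simp add: nn_integral_distr add.commute)
qed

text \<open>By Fubini the coordinates outside \<open>K\<close> can be held fixed; the map then
  translates each coordinate in \<open>K\<close> by a constant, and Lebesgue measure is translation
  invariant. A whole block moves at once so that one time step of all sequences is a single shear; a
  block of one coordinate gives an elementary row operation.\<close>

lemma distr_block_shear:
  fixes h :: "'i \<Rightarrow> ('i \<Rightarrow> 'b::euclidean_space) \<Rightarrow> 'b"
  assumes "finite J" and "K \<subseteq> J"
    and h: "\<And>k. k \<in> K \<Longrightarrow> h k \<in> borel_measurable (PiM (J - K) (\<lambda>_. borel))"
  defines "E \<equiv> \<lambda>x. \<lambda>j\<in>J. if j \<in> K then x j + h j (restrict x (J - K)) else x j"
  shows "E \<in> measurable (PiM J (\<lambda>_. lborel)) (PiM J (\<lambda>_. lborel))"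
    and "distr (PiM J (\<lambda>_. lborel)) (PiM J (\<lambda>_. lborel)) E = PiM J (\<lambda>_. lborel)"
proof -
  interpret L: product_sigma_finite "\<lambda>_::'i. lborel :: 'b measure" ..
  have fin: "finite K" "finite (J - K)" using assms finite_subset by auto
  have [measurable]: "(\<lambda>x. restrict x (J - K)) \<in> measurable (PiM J (\<lambda>_. lborel)) (PiM (J - K) (\<lambda>_. borel :: 'b measure))"
    by (rule measurable_restrict) (auto intro!: measurable_component_singleton)
  show E: "E \<in> measurable (PiM J (\<lambda>_. lborel)) (PiM J (\<lambda>_. lborel))"
    unfolding E_def
  proof (rule measurable_restrict)
    fix j assume j: "j \<in> J"
    show "(\<lambda>x. if j \<in> K then x j + h j (restrict x (J - K)) else x j)
      \<in> measurable (PiM J (\<lambda>_. lborel)) lborel"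
    proof (cases "j \<in> K")
      case True
      have "(\<lambda>x. h j (restrict x (J - K))) \<in> measurable (PiM J (\<lambda>_. lborel)) borel"
        by (rule measurable_compose[OF _ h[OF True]]) measurable
      then show ?thesis using True j by simp
    next
      case False
      then show ?thesis using j by simp
    qed
  qed
  show "distr (PiM J (\<lambda>_. lborel)) (PiM J (\<lambda>_. lborel)) E = PiM J (\<lambda>_. lborel)"
  proof (rule L.PiM_eqI[OF \<open>finite J\<close>])
    fix A :: "'i \<Rightarrow> 'b set" assume "\<And>j. j \<in> J \<Longrightarrow> A j \<in> sets lborel"
    then have A[measurable]: "j \<in> J \<Longrightarrow> A j \<in> sets borel" for j by simp
    have PA: "Pi\<^sub>E J A \<in> sets (PiM J (\<lambda>_. lborel))"
      using A \<open>finite J\<close> by (intro sets_PiM_I_finite) auto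
    have J: "J = (J - K) \<union> K" using \<open>K \<subseteq> J\<close> by auto
    have "emeasure (distr (PiM J (\<lambda>_. lborel)) (PiM J (\<lambda>_. lborel)) E) (Pi\<^sub>E J A)
      = (\<integral>\<^sup>+x. indicator (Pi\<^sub>E J A) (E x) \<partial>PiM J (\<lambda>_. lborel))"
      using E PA by (simp add: nn_integral_distr[symmetric])
    also have "\<dots> = (\<integral>\<^sup>+x. \<integral>\<^sup>+y. indicator (Pi\<^sub>E J A) (E (merge (J - K) K (x, y)))
        \<partial>PiM K (\<lambda>_. lborel) \<partial>PiM (J - K) (\<lambda>_. lborel))"
      using L.product_nn_integral_fold[of "J - K" K "\<lambda>x. indicator (Pi\<^sub>E J A) (E x)"] fin E PA J by auto
    \<comment> \<open>The block \<open>K\<close> is integrated inside, so that each translation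
      amount depends only on the outer variable.\<close>
    also have "\<dots> = (\<integral>\<^sup>+x. \<integral>\<^sup>+y. (\<Prod>j\<in>J - K. indicator (A j) (x j)) * (\<Prod>j\<in>K. indicator (A j) (y j + h j x))
        \<partial>PiM K (\<lambda>_. lborel) \<partial>PiM (J - K) (\<lambda>_. lborel))"
    proof (intro nn_integral_cong)
      fix x y :: "'i \<Rightarrow> 'b"
      assume x: "x \<in> space (PiM (J - K) (\<lambda>_. lborel))" and y: "y \<in> space (PiM K (\<lambda>_. lborel))"
      have r: "restrict (merge (J - K) K (x, y)) (J - K) = x"
        using x by (auto simp: space_PiM PiE_iff extensional_def restrict_def merge_def)
      have E1: "E (merge (J - K) K (x, y)) j = x j" if "j \<in> J - K" for j
        using that by (simp add: E_def)
      have E2: "E (merge (J - K) K (x, y)) j = y j + h j x" if "j \<in> K" for j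
        using that \<open>K \<subseteq> J\<close> by (auto simp: E_def r)
      have "E (merge (J - K) K (x, y)) \<in> Pi\<^sub>E J A \<longleftrightarrow> (\<forall>j\<in>J. E (merge (J - K) K (x, y)) j \<in> A j)"
        by (auto simp: E_def PiE_iff)
      also have "\<dots> \<longleftrightarrow> (\<forall>j\<in>J - K. x j \<in> A j) \<and> (\<forall>j\<in>K. y j + h j x \<in> A j)"
        using E1 E2 J by (metis Un_iff)
      finally show "indicator (Pi\<^sub>E J A) (E (merge (J - K) K (x, y))) =
        (\<Prod>j\<in>J - K. indicator (A j) (x j)) * (\<Prod>j\<in>K. indicator (A j) (y j + h j x) :: ennreal)"
        using fin by (auto simp: indicator_def prod_zero_iff)
    qed
    also have "\<dots> = (\<integral>\<^sup>+x. (\<Prod>j\<in>J - K. indicator (A j) (x j)) * (\<Prod>j\<in>K. emeasure lborel (A j))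
        \<partial>PiM (J - K) (\<lambda>_. lborel))"
    proof (intro nn_integral_cong)
      fix x :: "'i \<Rightarrow> 'b"
      have AK: "j \<in> K \<Longrightarrow> A j \<in> sets borel" for j using A \<open>K \<subseteq> J\<close> by auto
      have "(\<integral>\<^sup>+y. (\<Prod>j\<in>K. indicator (A j) (y j + h j x)) \<partial>PiM K (\<lambda>_. lborel))
          = (\<Prod>j\<in>K. \<integral>\<^sup>+y. indicator (A j) (y + h j x) \<partial>lborel)"
        using AK by (intro L.product_nn_integral_prod[OF fin(1), of "\<lambda>j z. indicator (A j) (z + h j x)"]) auto
      also have "\<dots> = (\<Prod>j\<in>K. emeasure lborel (A j))"
        using AK by (intro prod.cong refl, subst nn_integral_lborel_translate) auto
      finally have eq: "(\<integral>\<^sup>+y. (\<Prod>j\<in>K. indicator (A j) (y j + h j x)) \<partial>PiM K (\<lambda>_. lborel))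
          = (\<Prod>j\<in>K. emeasure lborel (A j))" .
      have "(\<lambda>y. \<Prod>j\<in>K. indicator (A j) (y j + h j x) :: ennreal) \<in> borel_measurable (PiM K (\<lambda>_. lborel))"
        using AK by (intro borel_measurable_prod_ennreal) (auto intro!: borel_measurable_indicator')
      then show "(\<integral>\<^sup>+y. (\<Prod>j\<in>J - K. indicator (A j) (x j)) * (\<Prod>j\<in>K. indicator (A j) (y j + h j x))
          \<partial>PiM K (\<lambda>_. lborel)) = (\<Prod>j\<in>J - K. indicator (A j) (x j)) * (\<Prod>j\<in>K. emeasure lborel (A j))"
        by (subst nn_integral_cmult) (auto simp: eq)
    qed
    also have "\<dots> = (\<integral>\<^sup>+x. (\<Prod>j\<in>J - K. indicator (A j) (x j)) \<partial>PiM (J - K) (\<lambda>_. lborel))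
        * (\<Prod>j\<in>K. emeasure lborel (A j))"
      using A by (intro nn_integral_multc borel_measurable_prod_ennreal) auto
    also have "(\<integral>\<^sup>+x. (\<Prod>j\<in>J - K. indicator (A j) (x j)) \<partial>PiM (J - K) (\<lambda>_. lborel))
        = (\<Prod>j\<in>J - K. emeasure lborel (A j))"
      using A by (subst L.product_nn_integral_prod[OF fin(2)]) auto
    also have "(\<Prod>j\<in>J - K. emeasure lborel (A j)) * (\<Prod>j\<in>K. emeasure lborel (A j))
        = (\<Prod>j\<in>J. emeasure lborel (A j))"
      using prod.subset_diff[OF \<open>K \<subseteq> J\<close> \<open>finite J\<close>] by metis
    finally show "emeasure (distr (PiM J (\<lambda>_. lborel)) (PiM J (\<lambda>_. lborel)) E) (Pi\<^sub>E J A)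
      = (\<Prod>j\<in>J. emeasure lborel (A j))" .
  qed simp
qed

text \<open>Both measures assign to a box the product of its side lengths. This carries arguments on
  product spaces, such as shears and coordinate permutations, over to vectors.\<close>

lemma distr_vec_lambda_lborel:
  "distr (PiM UNIV (\<lambda>_. lborel)) borel (\<lambda>f. \<chi> k. f k) = (lborel :: (real^'d) measure)"
proof (rule lborel_eqI[symmetric])
  interpret L: product_sigma_finite "\<lambda>_::'d. lborel :: real measure" ..
  have [measurable]: "(\<lambda>f. \<chi> k. f k) \<in> measurable (PiM (UNIV :: 'd set) (\<lambda>_. lborel)) (borel :: (real^'d) measure)"
    by (subst borel_measurable_euclidean_space) (auto simp: Basis_vec_def inner_axis)
  fix l u :: "real^'d" assume "\<And>b. b \<in> Basis \<Longrightarrow> l \<bullet> b \<le> u \<bullet> b"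
  then have le: "l $ k \<le> u $ k" for k by (metis axis_in_Basis_iff cart_eq_inner_axis Basis_real_def singletonI)
  have "(\<lambda>f. \<chi> k. f k) -` box l u \<inter> space (PiM UNIV (\<lambda>_. lborel)) = Pi\<^sub>E UNIV (\<lambda>k. {l $ k <..< u $ k})"
    by (auto simp: mem_box_cart space_PiM PiE_iff)
  then have "emeasure (distr (PiM UNIV (\<lambda>_. lborel)) borel (\<lambda>f. \<chi> k. f k)) (box l u)
      = (\<Prod>k\<in>UNIV. emeasure lborel {l $ k <..< u $ k})"
    by (subst emeasure_distr) (auto simp: L.emeasure_PiM)
  also have "\<dots> = ennreal (\<Prod>k\<in>UNIV. u $ k - l $ k)"
    using le by (simp add: prod_ennreal)
  also have "(\<Prod>k\<in>UNIV. u $ k - l $ k) = (\<Prod>b\<in>Basis. (u - l) \<bullet> b)"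
  proof -
    have "(\<Prod>b\<in>Basis. (u - l) \<bullet> b) = (\<Prod>b\<in>(\<lambda>k. axis k 1) ` UNIV. (u - l) \<bullet> b)"
      by (rule arg_cong2[where f=prod]) (auto simp: Basis_vec_def)
    also have "\<dots> = (\<Prod>k\<in>UNIV. (u - l) \<bullet> axis k 1)"
      by (subst prod.reindex) (auto simp: inj_on_def axis_eq_axis)
    finally show ?thesis by (simp add: inner_axis)
  qed
  finally show "emeasure (distr (PiM UNIV (\<lambda>_. lborel)) borel (\<lambda>f. \<chi> k. f k)) (box l u)
    = ennreal (\<Prod>b\<in>Basis. (u - l) \<bullet> b)" .
qed simp

text \<open>The linear change of variables in \<open>HOL-Analysis\<close> needs a well-ordered index type.\<close>

lemma nn_integral_lborel_matrix:
  fixes A :: "real^'d^'d" and f :: "real^'d \<Rightarrow> ennreal"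
  assumes f: "f \<in> borel_measurable borel" and A: "Determinants.det A \<noteq> 0"
  shows "ennreal \<bar>Determinants.det A\<bar> * (\<integral>\<^sup>+x. f (A *v x) \<partial>lborel) = (\<integral>\<^sup>+x. f x \<partial>lborel)"
proof -
  interpret L: product_sigma_finite "\<lambda>_::'d. lborel :: real measure" ..
  have [measurable]: "(\<lambda>f. \<chi> k. f k) \<in> measurable (PiM (UNIV :: 'd set) (\<lambda>_. lborel)) (borel :: (real^'d) measure)"
    by (subst borel_measurable_euclidean_space) (auto simp: Basis_vec_def inner_axis)
  have to_PiM: "(\<integral>\<^sup>+x. g x \<partial>lborel) = (\<integral>\<^sup>+y. g (\<chi> k. y k) \<partial>PiM UNIV (\<lambda>_. lborel))"
    if [measurable]: "g \<in> borel_measurable borel" for g :: "real^'d \<Rightarrow> ennreal"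
    by (subst distr_vec_lambda_lborel[symmetric], subst nn_integral_distr) auto
  have mv[measurable]: "(\<lambda>x. B *v x) \<in> borel_measurable borel" for B :: "real^'d^'d"
    by (intro borel_measurable_continuous_onI linear_continuous_on matrix_vector_mul_bounded_linear)
  \<comment> \<open>Nonvanishing of the determinant sits inside \<open>P\<close> as a premise: the
    generator with a zero row is then vacuous, and a product passes the premise to both
    factors.\<close>
  define P where "P B \<longleftrightarrow> Determinants.det B \<noteq> 0 \<longrightarrow> (\<forall>f\<in>borel_measurable borel.
    ennreal \<bar>Determinants.det B\<bar> * (\<integral>\<^sup>+x. f (B *v x) \<partial>lborel) = (\<integral>\<^sup>+x. f x \<partial>lborel))" for B :: "real^'d^'d"
  have "P A"
  proof (rule induct_matrix_elementary)
    fix A B :: "real^'d^'d" assume AB: "P A" "P B"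
    show "P (A ** B)"
      unfolding P_def
    proof (intro impI ballI)
      fix f :: "real^'d \<Rightarrow> ennreal" assume f[measurable]: "f \<in> borel_measurable borel"
        and "Determinants.det (A ** B) \<noteq> 0"
      then have "Determinants.det A \<noteq> 0" "Determinants.det B \<noteq> 0" by (auto simp: Determinants.det_mul)
      then have 1: "ennreal \<bar>Determinants.det B\<bar> * (\<integral>\<^sup>+x. f (A *v (B *v x)) \<partial>lborel) = (\<integral>\<^sup>+x. f (A *v x) \<partial>lborel)"
        and 2: "ennreal \<bar>Determinants.det A\<bar> * (\<integral>\<^sup>+x. f (A *v x) \<partial>lborel) = (\<integral>\<^sup>+x. f x \<partial>lborel)"
        using AB(2)[unfolded P_def, rule_format, of "\<lambda>x. f (A *v x)"] AB(1)[unfolded P_def, rule_format, of f]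
        by simp_all
      show "ennreal \<bar>Determinants.det (A ** B)\<bar> * (\<integral>\<^sup>+x. f (A ** B *v x) \<partial>lborel) = (\<integral>\<^sup>+x. f x \<partial>lborel)"
        unfolding 2[symmetric] 1[symmetric] Determinants.det_mul abs_mult
        by (simp add: ennreal_mult matrix_vector_mul_assoc mult.assoc)
    qed
  next
    fix A :: "real^'d^'d" and i assume "Finite_Cartesian_Product.row i A = 0"
    then show "P A" by (simp add: P_def Determinants.det_zero_row)
  next
    fix A :: "real^'d^'d" assume A: "\<And>i j. i \<noteq> j \<Longrightarrow> A $ i $ j = 0"
    show "P A"
      unfolding P_def
    proof (intro impI ballI)
      fix f :: "real^'d \<Rightarrow> ennreal" assume f[measurable]: "f \<in> borel_measurable borel"
        and "Determinants.det A \<noteq> 0"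
      then have nz: "A $ k $ k \<noteq> 0" for k by (simp add: Determinants.det_diagonal[OF A])
      \<comment> \<open>The scaling lemma for Lebesgue measure takes its factors as a function of
        basis vectors. This \<open>c\<close> sends the k-th unit vector to the k-th diagonal
        entry.\<close>
      define c where "c b = (\<Sum>k\<in>UNIV. A $ k $ k * (b $ k))" for b :: "real^'d"
      have c: "c (axis k 1) = A $ k $ k" for k
        by (simp add: c_def axis_def if_distrib cong: if_cong)
      have Basis: "(Basis :: (real^'d) set) = (\<lambda>k. axis k 1) ` UNIV" by (auto simp: Basis_vec_def)
      have inj: "inj (\<lambda>k. axis k 1 :: real^'d)" by (auto simp: inj_on_def axis_eq_axis)
      have Ax: "A *v x = (\<Sum>j\<in>Basis. (c j * (x \<bullet> j)) *\<^sub>R j)" for x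
      proof -
        have "(A *v x) $ k = A $ k $ k * x $ k" for k
          by (simp add: A sum.remove[where x=k] matrix_vector_mult_def)
        moreover have "(\<Sum>j\<in>UNIV. (A $ j $ j * x $ j) *\<^sub>R axis j 1) $ k = A $ k $ k * x $ k" for k
          by (simp add: axis_def if_distrib cong: if_cong)
        moreover have "(\<Sum>j\<in>Basis. (c j * (x \<bullet> j)) *\<^sub>R j) = (\<Sum>j\<in>UNIV. (A $ j $ j * x $ j) *\<^sub>R axis j 1)"
          by (simp add: Basis sum.reindex[OF inj] c inner_axis)
        ultimately show ?thesis by (simp only: Finite_Cartesian_Product.vec_eq_iff) blast
      qed
      have "(\<Prod>j\<in>Basis. \<bar>c j\<bar>) = \<bar>Determinants.det A\<bar>"
        by (simp add: Basis prod.reindex[OF inj] c Determinants.det_diagonal[OF A] abs_prod)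
      then have "lborel = density (distr lborel borel (\<lambda>x. A *v x)) (\<lambda>_. ennreal \<bar>Determinants.det A\<bar>)"
      proof -
        have "c j \<noteq> 0" if "j \<in> Basis" for j using that nz by (auto simp: Basis c)
        with \<open>(\<Prod>j\<in>Basis. \<bar>c j\<bar>) = _\<close> show ?thesis
          using lborel_affine_euclidean[of c 0] by (simp add: Ax)
      qed
      then have "(\<integral>\<^sup>+x. f x \<partial>lborel) = (\<integral>\<^sup>+x. f x \<partial>density (distr lborel borel (\<lambda>x. A *v x)) (\<lambda>_. ennreal \<bar>Determinants.det A\<bar>))"
        by simp
      also have "\<dots> = ennreal \<bar>Determinants.det A\<bar> * (\<integral>\<^sup>+x. f (A *v x) \<partial>lborel)"
        by (simp add: nn_integral_density nn_integral_distr nn_integral_cmult)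
      finally show "ennreal \<bar>Determinants.det A\<bar> * (\<integral>\<^sup>+x. f (A *v x) \<partial>lborel) = (\<integral>\<^sup>+x. f x \<partial>lborel)" by simp
    qed
  next
    fix m n :: 'd assume mn: "m \<noteq> n"
    let ?s = "Transposition.transpose m n" and ?A = "(\<chi> i j. Finite_Cartesian_Product.mat 1 $ i $ Transposition.transpose m n j) :: real^'d^'d"
    have s: "?s permutes UNIV" by (simp add: permutes_swap_id)
    have det: "\<bar>Determinants.det ?A\<bar> = 1"
      using det_permute_columns[OF s, of "Finite_Cartesian_Product.mat 1 :: real^'d^'d"] by (simp add: sign_def)
    have Ax: "?A *v x = (\<chi> i. x $ ?s i)" for x
    proof -
      have "(\<Sum>j\<in>UNIV. (if i = ?s j then 1 else 0) * x $ j) = x $ ?s i" for i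
      proof -
        have "i = ?s j \<longleftrightarrow> j = ?s i" for j by (metis transpose_involutory)
        then show ?thesis by (simp add: if_distrib if_distribR cong: if_cong)
      qed
      then show ?thesis by (simp add: matrix_vector_mult_def Finite_Cartesian_Product.vec_eq_iff Finite_Cartesian_Product.mat_def)
    qed
    show "P ?A"
      unfolding P_def
    proof (intro impI ballI)
      fix f :: "real^'d \<Rightarrow> ennreal" assume f[measurable]: "f \<in> borel_measurable borel"
      let ?R = "\<lambda>y. \<lambda>k\<in>UNIV. y (?s k)"
      have [measurable]: "?R \<in> measurable (PiM UNIV (\<lambda>_. lborel :: real measure)) (PiM UNIV (\<lambda>_. lborel))"
        by (rule measurable_restrict) simp
      \<comment> \<open>A transposition only reorders the identical factors of the product measure,
        as seen on rectangles.\<close>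
      have R: "distr (PiM UNIV (\<lambda>_. lborel :: real measure)) (PiM UNIV (\<lambda>_. lborel)) ?R = PiM UNIV (\<lambda>_. lborel)"
      proof (rule L.PiM_eqI)
        fix B :: "'d \<Rightarrow> real set" assume B: "\<And>k. k \<in> UNIV \<Longrightarrow> B k \<in> sets lborel"
        have "?R -` Pi\<^sub>E UNIV B \<inter> space (PiM UNIV (\<lambda>_. lborel)) = Pi\<^sub>E UNIV (\<lambda>k. B (?s k))"
          by (auto simp: space_PiM PiE_iff) (metis transpose_involutory)+
        then have "emeasure (distr (PiM UNIV (\<lambda>_. lborel)) (PiM UNIV (\<lambda>_. lborel)) ?R) (Pi\<^sub>E UNIV B)
            = (\<Prod>k\<in>UNIV. emeasure lborel (B (?s k)))"
          using B by (subst emeasure_distr) (auto simp: L.emeasure_PiM intro!: sets_PiM_I_finite)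
        also have "\<dots> = (\<Prod>k\<in>UNIV. emeasure lborel (B k))"
          by (rule prod.permute[OF s, unfolded comp_def, symmetric])
        finally show "emeasure (distr (PiM UNIV (\<lambda>_. lborel)) (PiM UNIV (\<lambda>_. lborel)) ?R) (Pi\<^sub>E UNIV B)
            = (\<Prod>k\<in>UNIV. emeasure lborel (B k))" .
      qed auto
      have "(\<integral>\<^sup>+x. f x \<partial>lborel) = (\<integral>\<^sup>+y. f (\<chi> k. ?R y k) \<partial>PiM UNIV (\<lambda>_. lborel))"
        unfolding to_PiM[OF f] by (subst R[symmetric], subst nn_integral_distr) auto
      also have "\<dots> = (\<integral>\<^sup>+x. f (?A *v x) \<partial>lborel)"
        unfolding to_PiM[OF measurable_compose[OF mv f]] by (simp add: Ax restrict_UNIV)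
      finally show "ennreal \<bar>Determinants.det ?A\<bar> * (\<integral>\<^sup>+x. f (?A *v x) \<partial>lborel) = (\<integral>\<^sup>+x. f x \<partial>lborel)"
        unfolding det by simp
    qed
  next
    fix m n :: 'd and c :: real assume mn: "m \<noteq> n"
    let ?A = "(\<chi> i j. if i = m \<and> j = n then c else of_bool (i = j)) :: real^'d^'d"
    have "(\<chi> k. if k = m then Finite_Cartesian_Product.row m (Finite_Cartesian_Product.mat 1) + c *s Finite_Cartesian_Product.row n (Finite_Cartesian_Product.mat 1) else Finite_Cartesian_Product.row k (Finite_Cartesian_Product.mat 1)) = ?A"
      using mn by (auto simp: Finite_Cartesian_Product.vec_eq_iff Finite_Cartesian_Product.row_def Finite_Cartesian_Product.mat_def)
    then have det: "Determinants.det ?A = 1"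
      using det_row_operation[OF mn, of "Finite_Cartesian_Product.mat 1" c] by simp
    have Ax: "?A *v x = (\<chi> k. if k = m then x $ m + c * x $ n else x $ k)" for x
    proof -
      have "(\<Sum>j\<in>UNIV. (if j = n then c else of_bool (m = j)) * x $ j) = x $ m + c * x $ n"
        using mn by (subst sum.remove[of _ n], simp, simp, subst sum.remove[of _ m], simp, simp)
          (simp add: sum.neutral)
      moreover have "(\<Sum>j\<in>UNIV. of_bool (i = j) * x $ j) = x $ i" for i
        by (simp add: of_bool_def if_distrib if_distribR cong: if_cong)
      ultimately show ?thesis by (auto simp: matrix_vector_mult_def Finite_Cartesian_Product.vec_eq_iff)
    qed
    show "P ?A"
      unfolding P_def
    proof (intro impI ballI)
      fix f :: "real^'d \<Rightarrow> ennreal" assume f[measurable]: "f \<in> borel_measurable borel"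
      \<comment> \<open>Adding c times coordinate n to coordinate m is a shear with block {m}; it is
        legitimate because n differs from m.\<close>
      let ?E = "\<lambda>y. \<lambda>j\<in>UNIV. if j \<in> {m} then y j + c * restrict y (UNIV - {m}) n else y j"
      note E = distr_block_shear[of UNIV "{m}" "\<lambda>_ y. c * y n"]
      have nm: "n \<in> UNIV - {m}" using mn by auto
      have meas: "(\<lambda>y. c * y n) \<in> borel_measurable (PiM (UNIV - {m}) (\<lambda>_. borel))"
        using nm by measurable
      have [measurable]: "?E \<in> measurable (PiM UNIV (\<lambda>_. lborel)) (PiM UNIV (\<lambda>_. lborel))"
        by (rule E(1)) (use meas in auto)
      have "(\<integral>\<^sup>+x. f x \<partial>lborel) = (\<integral>\<^sup>+y. f (\<chi> k. ?E y k) \<partial>PiM UNIV (\<lambda>_. lborel))"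
        unfolding to_PiM[OF f] by (subst E(2)[symmetric], use meas in simp_all) (subst nn_integral_distr, auto)
      also have "\<dots> = (\<integral>\<^sup>+x. f (?A *v x) \<partial>lborel)"
        unfolding to_PiM[OF measurable_compose[OF mv f]]
        using nm by (auto simp: Ax Finite_Cartesian_Product.vec_eq_iff intro!: nn_integral_cong arg_cong[where f=f])
      finally show "ennreal \<bar>Determinants.det ?A\<bar> * (\<integral>\<^sup>+x. f (?A *v x) \<partial>lborel) = (\<integral>\<^sup>+x. f x \<partial>lborel)"
        unfolding det by simp
    qed
  qed
  then show ?thesis using A f by (auto simp: P_def)
qed

section \<open>Laws of linear images and of autoregressive sequences\<close>

lemma (in prob_space) indep_vars_cong_space:
  assumes "indep_vars N X I" and eq: "\<And>i \<omega>. i \<in> I \<Longrightarrow> \<omega> \<in> space M \<Longrightarrow> X i \<omega> = Y i \<omega>"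
  shows "indep_vars N Y I"
proof -
  have "X i -` A \<inter> space M = Y i -` A \<inter> space M" if "i \<in> I" for i A
    using eq[OF that] by auto
  moreover have "random_variable (N i) (X i) \<longleftrightarrow> random_variable (N i) (Y i)" if "i \<in> I" for i
    using eq[OF that] by (intro measurable_cong) auto
  ultimately show ?thesis
    using assms(1) unfolding indep_vars_def2 by (simp cong: indep_sets_cong)
qed

text \<open>A rectangle condition on all pairs is, for each i, a rectangle condition on the block of
  i. Independence of the blocks splits the probability over i, and independence inside each block
  splits it over j.\<close>

lemma (in prob_space) indep_vars_Sigma:
  assumes I: "finite I" "I \<noteq> {}" and J: "\<And>i. i \<in> I \<Longrightarrow> finite (J i)" "\<And>i. i \<in> I \<Longrightarrow> J i \<noteq> {}"
    and outer: "indep_vars (\<lambda>i. PiM (J i) (N i)) (\<lambda>i \<omega>. \<lambda>j\<in>J i. X i j \<omega>) I"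
    and inner: "\<And>i. i \<in> I \<Longrightarrow> indep_vars (N i) (X i) (J i)"
  shows "indep_vars (\<lambda>(i, j). N i j) (\<lambda>(i, j). X i j) (SIGMA i:I. J i)"
proof -
  have rv: "random_variable (N i j) (X i j)" if "i \<in> I" "j \<in> J i" for i j
    using inner[OF that(1)] that by (simp add: indep_vars_def)
  have ne: "(SIGMA i:I. J i) \<noteq> {}" using I(2) J(2) by blast
  show ?thesis
  proof (subst indep_vars_finite[where E="\<lambda>(i, j). sets (N i j)"])
    show "\<forall>A\<in>\<Pi> p\<in>(SIGMA i:I. J i). (case p of (i, j) \<Rightarrow> sets (N i j)).
      prob (\<Inter>p\<in>(SIGMA i:I. J i). (case p of (i, j) \<Rightarrow> X i j) -` A p \<inter> space M) =
      (\<Prod>p\<in>(SIGMA i:I. J i). prob ((case p of (i, j) \<Rightarrow> X i j) -` A p \<inter> space M))"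
    proof
      fix A assume "A \<in> (\<Pi> p\<in>(SIGMA i:I. J i). (case p of (i, j) \<Rightarrow> sets (N i j)))"
      then have A: "A (i, j) \<in> sets (N i j)" if "i \<in> I" "j \<in> J i" for i j using that by auto
      let ?C = "\<lambda>i. Pi\<^sub>E (J i) (\<lambda>j. A (i, j))"
      \<comment> \<open>Nonempty blocks matter here: an intersection over an empty index set would
        be the whole type instead of the sample space.\<close>
      have C: "(\<lambda>\<omega>. \<lambda>j\<in>J i. X i j \<omega>) -` ?C i \<inter> space M = (\<Inter>j\<in>J i. X i j -` A (i, j) \<inter> space M)"
        if "i \<in> I" for i using J(2)[OF that] by auto
      have "(\<Inter>p\<in>(SIGMA i:I. J i). (case p of (i, j) \<Rightarrow> X i j) -` A p \<inter> space M)
          = (\<Inter>i\<in>I. (\<lambda>\<omega>. \<lambda>j\<in>J i. X i j \<omega>) -` ?C i \<inter> space M)"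
      proof -
        have "(\<Inter>p\<in>(SIGMA i:I. J i). (case p of (i, j) \<Rightarrow> X i j) -` A p \<inter> space M)
          = (\<Inter>i\<in>I. \<Inter>j\<in>J i. X i j -` A (i, j) \<inter> space M)"
          by (auto simp del: INT_simps)
        also have "\<dots> = (\<Inter>i\<in>I. (\<lambda>\<omega>. \<lambda>j\<in>J i. X i j \<omega>) -` ?C i \<inter> space M)"
          by (intro INF_cong refl C[symmetric])
        finally show ?thesis .
      qed
      then have "prob (\<Inter>p\<in>(SIGMA i:I. J i). (case p of (i, j) \<Rightarrow> X i j) -` A p \<inter> space M)
          = (\<Prod>i\<in>I. prob ((\<lambda>\<omega>. \<lambda>j\<in>J i. X i j \<omega>) -` ?C i \<inter> space M))"
        using indep_varsD_finite[OF outer I(2,1), of ?C] A J(1) by (auto intro: sets_PiM_I_finite)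
      also have "\<dots> = (\<Prod>i\<in>I. \<Prod>j\<in>J i. prob (X i j -` A (i, j) \<inter> space M))"
      proof (intro prod.cong refl)
        fix i assume i: "i \<in> I"
        show "prob ((\<lambda>\<omega>. \<lambda>j\<in>J i. X i j \<omega>) -` ?C i \<inter> space M) = (\<Prod>j\<in>J i. prob (X i j -` A (i, j) \<inter> space M))"
          unfolding C[OF i] using i J A by (intro indep_varsD_finite[OF inner]) auto
      qed
      also have "\<dots> = (\<Prod>p\<in>(SIGMA i:I. J i). prob ((case p of (i, j) \<Rightarrow> X i j) -` A p \<inter> space M))"
        using I J by (subst prod.Sigma) (auto intro!: prod.cong)
      finally show "prob (\<Inter>p\<in>(SIGMA i:I. J i). (case p of (i, j) \<Rightarrow> X i j) -` A p \<inter> space M) =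
        (\<Prod>p\<in>(SIGMA i:I. J i). prob ((case p of (i, j) \<Rightarrow> X i j) -` A p \<inter> space M))" .
    qed
  qed (use I J rv ne in \<open>auto simp: sets.sigma_sets_eq sets.Int_stable dest: sets.sets_into_space\<close>)
qed

text \<open>For v > 0 and invertible \<open>W\<close>, this is the density of the centered normal
  law with covariance v W W^T, in whitened coordinates. In this form it is the image density under
  \<open>W\<close> and is a product over components.\<close>

definition linear_normal_density :: "real^'d^'d \<Rightarrow> real \<Rightarrow> real^'d \<Rightarrow> real" where
  "linear_normal_density W v y =
     (\<Prod>k\<in>UNIV. normal_density 0 (sqrt v) ((matrix_inv W *v y) $ k)) / \<bar>Determinants.det W\<bar>"

lemma borel_measurable_matrix_vector_mult[measurable]:
  "(\<lambda>x. (A :: real^'d^'e) *v x) \<in> borel_measurable borel"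
  by (intro borel_measurable_continuous_onI linear_continuous_on matrix_vector_mul_bounded_linear)

lemma borel_measurable_vec_component[measurable]: "(\<lambda>x :: real^'d. x $ k) \<in> borel_measurable borel"
  by (intro borel_measurable_continuous_onI continuous_intros)

lemma borel_measurable_linear_normal_density[measurable]:
  "linear_normal_density W v \<in> borel_measurable borel"
  unfolding linear_normal_density_def[abs_def] by measurable

lemma
  fixes A :: "'b::semiring_1^'m^'n"
  assumes "invertible A"
  shows matrix_inv_right: "A ** matrix_inv A = Finite_Cartesian_Product.mat 1"
    and matrix_inv_left: "matrix_inv A ** A = Finite_Cartesian_Product.mat 1"
  using someI_ex[OF assms[unfolded invertible_def]] by (simp_all add: matrix_inv_def)

lemma distr_density_matrix:
  fixes W :: "real^'d^'d" and F :: "real^'d \<Rightarrow> ennreal"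
  assumes [measurable]: "F \<in> borel_measurable borel" and W: "Determinants.det W \<noteq> 0"
  shows "distr (density lborel F) borel (\<lambda>x. W *v x)
    = density lborel (\<lambda>y. F (matrix_inv W *v y) / ennreal \<bar>Determinants.det W\<bar>)"
proof (rule measure_eqI)
  have inv: "matrix_inv W *v (W *v x) = x" for x
    using W by (simp add: matrix_vector_mul_assoc matrix_inv_left invertible_det_nz)
  let ?c = "ennreal \<bar>Determinants.det W\<bar>"
  have c: "?c \<noteq> 0" "?c \<noteq> \<top>" using W by (simp_all add: ennreal_eq_0_iff)
  fix A assume "A \<in> sets (distr (density lborel F) borel (\<lambda>x. W *v x))"
  then have [measurable]: "A \<in> sets borel" by simp
  have "emeasure (density lborel (\<lambda>y. F (matrix_inv W *v y) / ?c)) A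
      = (\<integral>\<^sup>+y. F (matrix_inv W *v y) / ?c * indicator A y \<partial>lborel)"
    by (intro emeasure_density) measurable
  also have "\<dots> = ?c * (\<integral>\<^sup>+x. F (matrix_inv W *v (W *v x)) / ?c * indicator A (W *v x) \<partial>lborel)"
    by (intro nn_integral_lborel_matrix[symmetric] W) measurable
  also have "\<dots> = (\<integral>\<^sup>+x. ?c * (F x / ?c * indicator A (W *v x)) \<partial>lborel)"
    unfolding inv by (intro nn_integral_cmult[symmetric]) measurable
  also have "\<dots> = (\<integral>\<^sup>+x. F x * indicator A (W *v x) \<partial>lborel)"
  proof (rule nn_integral_cong)
    fix x
    have "?c * (F x / ?c) = F x"
      by (metis c ennreal_times_divide mult.commute mult_divide_eq_ennreal)
    then show "?c * (F x / ?c * indicator A (W *v x)) = F x * indicator A (W *v x)"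
      by (simp only: mult.assoc[symmetric])
  qed
  also have "\<dots> = emeasure (distr (density lborel F) borel (\<lambda>x. W *v x)) A"
  proof -
    have "(\<lambda>x. W *v x) -` A \<in> sets borel"
      by (rule measurable_sets_borel[OF borel_measurable_matrix_vector_mult]) measurable
    then show ?thesis
      by (simp add: emeasure_distr emeasure_density indicator_vimage[symmetric])
  qed
  finally show "emeasure (distr (density lborel F) borel (\<lambda>x. W *v x)) A
      = emeasure (density lborel (\<lambda>y. F (matrix_inv W *v y) / ?c)) A" by simp
qed simp

text \<open>Independence turns the law of the coordinates into a product of normal densities;
  \<open>distr_vec_lambda_lborel\<close> moves it to the vector space, and the linear change of
  variables applies \<open>W\<close>.\<close>

lemma (in prob_space) distr_linear_normal:
  fixes D :: "'d::finite \<Rightarrow> 'a \<Rightarrow> real" and W :: "real^'d^'d"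
  assumes ind: "indep_vars (\<lambda>_. borel) D UNIV" and law: "\<And>k. normal_law M (D k) 0 v" and v: "0 < v"
    and W: "Determinants.det W \<noteq> 0"
  shows "distr M borel (\<lambda>\<omega>. W *v (\<chi> k. D k \<omega>)) = density lborel (linear_normal_density W v)"
proof -
  have D[measurable]: "D k \<in> borel_measurable M" for k using law normal_law_measurable by blast
  let ?V = "\<lambda>f. \<chi> k. f k" and ?n = "\<lambda>x. ennreal (normal_density 0 (sqrt v) x)"
  have V: "?V \<in> measurable (PiM (UNIV :: 'd set) (\<lambda>_. borel)) (borel :: (real^'d) measure)"
    by (subst borel_measurable_euclidean_space) (auto simp: Basis_vec_def inner_axis)
  have sets: "sets (PiM (UNIV :: 'd set) (\<lambda>_. lborel :: real measure)) = sets (PiM UNIV (\<lambda>_. borel))"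
    by (rule sets_PiM_cong) auto
  have V'[measurable]: "?V \<in> measurable (PiM (UNIV :: 'd set) (\<lambda>_. lborel)) (borel :: (real^'d) measure)"
    using V by (simp cong: measurable_cong_sets add: sets)
  have Dk: "distr M borel (D k) = density lborel ?n" for k
    using law[of k] v by (simp add: normal_law_def)
  have DP[measurable]: "(\<lambda>\<omega>. \<lambda>k\<in>UNIV. D k \<omega>) \<in> measurable M (PiM UNIV (\<lambda>_. borel))"
    by (rule measurable_restrict) simp
  let ?F = "\<lambda>x :: real^'d. \<Prod>k\<in>UNIV. ?n (x $ k)"
  have F[measurable]: "?F \<in> borel_measurable borel" by measurable
  have "distr M (PiM UNIV (\<lambda>_. borel)) (\<lambda>\<omega>. \<lambda>k\<in>UNIV. D k \<omega>) = PiM UNIV (\<lambda>k. distr M borel (D k))"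
    using ind by (subst indep_vars_iff_distr_eq_PiM'[symmetric]) auto
  also have "\<dots> = density (PiM UNIV (\<lambda>_. lborel)) (\<lambda>x. \<Prod>k\<in>UNIV. ?n (x k))"
    unfolding Dk using v by (intro density_PiM_lborel) (auto intro: prob_space_normal_density)
  finally have P: "distr M (PiM UNIV (\<lambda>_. borel)) (\<lambda>\<omega>. \<lambda>k\<in>UNIV. D k \<omega>) = \<dots>" .
  have "distr M borel (\<lambda>\<omega>. \<chi> k. D k \<omega>)
      = distr (distr M (PiM UNIV (\<lambda>_. borel)) (\<lambda>\<omega>. \<lambda>k\<in>UNIV. D k \<omega>)) borel ?V"
    by (subst distr_distr[OF V DP]) (simp add: comp_def restrict_UNIV)
  also have "\<dots> = density (distr (PiM UNIV (\<lambda>_. lborel)) borel ?V) ?F"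
    unfolding P by (subst density_distr[OF _ V']) (simp_all add: F)
  also have "\<dots> = density lborel ?F" unfolding distr_vec_lambda_lborel ..
  finally have vec: "distr M borel (\<lambda>\<omega>. \<chi> k. D k \<omega>) = density lborel ?F" .
  have vm[measurable]: "(\<lambda>\<omega>. \<chi> k. D k \<omega>) \<in> borel_measurable M"
    by (subst borel_measurable_euclidean_space) (auto simp: Basis_vec_def inner_axis)
  have "distr M borel (\<lambda>\<omega>. W *v (\<chi> k. D k \<omega>))
      = distr (distr M borel (\<lambda>\<omega>. \<chi> k. D k \<omega>)) borel (\<lambda>x. W *v x)"
    by (subst distr_distr) (auto simp: comp_def)
  also have "\<dots> = density lborel (\<lambda>y. ?F (matrix_inv W *v y) / ennreal \<bar>Determinants.det W\<bar>)"
    unfolding vec by (rule distr_density_matrix[OF F W])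
  also have "\<dots> = density lborel (linear_normal_density W v)"
    using W by (simp add: linear_normal_density_def prod_ennreal prod_nonneg divide_ennreal)
  finally show ?thesis .
qed

text \<open>The independent family \<open>G\<close> is converted into \<open>X\<close> one time
  level at a time. Each conversion adds a function of the previous level, so it is a shear and the
  density is merely re-expressed in the new coordinates. Constancy of \<open>p k 1\<close> expresses
  that the first level has no predecessor inside \<open>I\<close>.\<close>

lemma (in prob_space) distributed_autoregression:
  fixes X G :: "'k \<Rightarrow> nat \<Rightarrow> 'a \<Rightarrow> 'b::euclidean_space" and p :: "'k \<Rightarrow> nat \<Rightarrow> 'b \<Rightarrow> 'b"
    and g :: "'k \<Rightarrow> nat \<Rightarrow> 'b \<Rightarrow> ennreal"
  assumes fin: "finite I" and ne: "I \<noteq> {}" and I0: "\<And>k. (k, 0) \<notin> I"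
    and I_down: "\<And>k t. (k, Suc t) \<in> I \<Longrightarrow> 0 < t \<Longrightarrow> (k, t) \<in> I"
    and ind: "indep_vars (\<lambda>_. borel) (\<lambda>(k, t). G k t) I"
    and law: "\<And>k t. (k, t) \<in> I \<Longrightarrow> distr M borel (G k t) = density lborel (g k t)"
    and g: "\<And>k t. g k t \<in> borel_measurable borel" and p: "\<And>k t. p k t \<in> borel_measurable borel"
    and p1: "\<And>k y z. p k 1 y = p k 1 z"
    and X: "\<And>k t \<omega>. (k, t) \<in> I \<Longrightarrow> \<omega> \<in> space M \<Longrightarrow> X k t \<omega> = G k t \<omega> + p k t (X k (t - 1) \<omega>)"
    and Xm: "\<And>k t. (k, t) \<in> I \<Longrightarrow> X k t \<in> borel_measurable M"
  shows "distributed M (PiM I (\<lambda>_. lborel)) (\<lambda>\<omega>. \<lambda>(k, t)\<in>I. X k t \<omega>)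
    (\<lambda>x. \<Prod>(k, t)\<in>I. g k t (x (k, t) - p k t (x (k, t - 1))))"
proof -
  let ?L = "PiM I (\<lambda>_. lborel :: 'b measure)"
  have Gm: "G k t \<in> borel_measurable M" if "(k, t) \<in> I" for k t
    using ind that by (auto simp: indep_vars_def)
  have prob: "prob_space (density lborel (g k t))" if "(k, t) \<in> I" for k t
    unfolding law[OF that, symmetric] using Gm[OF that] by (rule prob_space_distr)
  \<comment> \<open>At t = 1 the coordinate (k, 0) is not in the product, so measurability must come
    from constancy of \<open>p k 1\<close>.\<close>
  have pm: "(\<lambda>x. p k t (x (k, t - 1))) \<in> borel_measurable (PiM J (\<lambda>_. N))"
    if "(k, t) \<in> I" "t \<noteq> 1 \<Longrightarrow> (k, t - 1) \<in> J" "sets N = sets borel" for k t J N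
  proof (cases "t = 1")
    case True
    then have "(\<lambda>x. p k t (x (k, t - 1))) = (\<lambda>x. p k t 0)" using p1 by auto
    then show ?thesis by simp
  next
    case False
    then have "(k, t - 1) \<in> J" using that by auto
    then have "(\<lambda>x. x (k, t - 1)) \<in> measurable (PiM J (\<lambda>_. N)) N" by simp
    then have "(\<lambda>x. x (k, t - 1)) \<in> borel_measurable (PiM J (\<lambda>_. N))"
      using that(3) by (simp cong: measurable_cong_sets)
    then show ?thesis by (rule measurable_compose) (rule p)
  qed
  \<comment> \<open>Hybrid between the two families: \<open>X\<close> up to time m and
    \<open>G\<close> afterwards. \<open>f m\<close> is its density, with the prediction subtracted
    only at the converted times.\<close>
  define Z where "Z m \<omega> = (\<lambda>(k, t)\<in>I. if t \<le> m then X k t \<omega> else G k t \<omega>)" for m \<omega>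
  define f where "f m x = (\<Prod>(k, t)\<in>I. g k t (x (k, t) - (if t \<le> m then p k t (x (k, t - 1)) else 0)))"
    for m and x :: "'k \<times> nat \<Rightarrow> 'b"
  have Zm: "Z m \<in> measurable M ?L" for m
    unfolding Z_def[abs_def]
  proof (rule measurable_restrict)
    fix q assume "q \<in> I"
    then show "(\<lambda>\<omega>. case q of (k, t) \<Rightarrow> if t \<le> m then X k t \<omega> else G k t \<omega>) \<in> measurable M lborel"
      using Xm Gm by (cases q) auto
  qed
  have fm: "f m \<in> borel_measurable ?L" for m
    unfolding f_def[abs_def]
  proof (rule borel_measurable_prod_ennreal)
    fix q assume q: "q \<in> I"
    obtain k t where kt: "q = (k, t)" by (cases q)
    have "t \<noteq> 0" using q I0 kt by (cases t) auto
    then have prev: "t \<noteq> 1 \<Longrightarrow> (k, t - 1) \<in> I" using I_down[of k "t - 1"] q kt by simp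
    have "(\<lambda>x. x (k, t) - (if t \<le> m then p k t (x (k, t - 1)) else 0)) \<in> borel_measurable ?L"
      using pm[of k t I lborel] prev q kt by (cases "t \<le> m") (auto intro!: borel_measurable_diff)
    then show "(\<lambda>x. case q of (k, t) \<Rightarrow> g k t (x (k, t) - (if t \<le> m then p k t (x (k, t - 1)) else 0)))
      \<in> borel_measurable ?L"
      unfolding kt prod.case by (rule measurable_compose) (rule g)
  qed
  have "distr M ?L (Z m) = density ?L (f m)" for m
  proof (induction m)
    case 0
    have Z0: "Z 0 = (\<lambda>\<omega>. \<lambda>q\<in>I. (\<lambda>(k, t). G k t) q \<omega>)"
      using I0 by (auto simp: Z_def fun_eq_iff restrict_def)
    have "distr M ?L (Z 0) = distr M (PiM I (\<lambda>_. borel)) (Z 0)"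
      by (intro distr_cong refl sets_PiM_cong) auto
    also have "\<dots> = PiM I (\<lambda>q. distr M borel ((\<lambda>(k, t). G k t) q))"
      unfolding Z0 using ind Gm ne by (subst indep_vars_iff_distr_eq_PiM'[symmetric]) auto
    also have "\<dots> = PiM I (\<lambda>q. density lborel ((\<lambda>(k, t). g k t) q))"
      using law by (intro PiM_cong) auto
    also have "\<dots> = density ?L (\<lambda>x. \<Prod>q\<in>I. (\<lambda>(k, t). g k t) q (x q))"
      using g prob by (intro density_PiM_lborel fin) auto
    also have "(\<lambda>x. \<Prod>q\<in>I. (\<lambda>(k, t). g k t) q (x q)) = f 0"
      using I0 unfolding f_def by (intro ext prod.cong) auto
    finally show ?case .
  next
    case (Suc m)
    \<comment> \<open>All indices at time level m + 1, over every k, form one block. Their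
      predecessors lie at level m and hence outside the block.\<close>
    define K where "K = {(k, t). (k, t) \<in> I \<and> t = Suc m}"
    define h where "h = (\<lambda>(k, t) x. p k t (x (k, t - 1) :: 'b))"
    define E where "E = (\<lambda>x. \<lambda>q\<in>I. if q \<in> K then x q + h q (restrict x (I - K)) else x q)"
    have KI: "K \<subseteq> I" by (auto simp: K_def)
    have prev: "(k, m) \<in> I - K" if "(k, Suc m) \<in> I" "Suc m \<noteq> 1" for k
      using that I_down by (auto simp: K_def)
    have hm: "h q \<in> borel_measurable (PiM (I - K) (\<lambda>_. borel))" if q: "q \<in> K" for q
    proof -
      obtain k where "q = (k, Suc m)" "(k, Suc m) \<in> I" using q by (auto simp: K_def)
      then show ?thesis using pm[of k "Suc m" "I - K" borel] prev[of k] by (simp add: h_def)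
    qed
    note shear = distr_block_shear[OF fin KI, of h, folded E_def, OF hm]
    have hE: "h (k, Suc m) (restrict x (I - K)) = p k (Suc m) (x (k, m))" if "(k, Suc m) \<in> I" for k x
    proof (cases "m = 0")
      case True
      then show ?thesis using p1 by (simp add: h_def)
    next
      case False
      then show ?thesis using prev[OF that] by (simp add: h_def)
    qed
    have Eapp: "E x (k, t) = (if t = Suc m then x (k, t) + p k t (x (k, m)) else x (k, t))"
      if "(k, t) \<in> I" for x k t
      using that hE[of k x] by (auto simp: E_def K_def)
    have ZS: "Z (Suc m) \<omega> = E (Z m \<omega>)" if \<omega>: "\<omega> \<in> space M" for \<omega>
    proof
      fix q :: "'k \<times> nat"
      obtain k t where q: "q = (k, t)" by (cases q)
      show "Z (Suc m) \<omega> q = E (Z m \<omega>) q"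
      proof (cases "q \<in> I")
        case False
        then show ?thesis by (simp add: Z_def E_def)
      next
        case True
        then have kt: "(k, t) \<in> I" using q by simp
        show ?thesis
        proof (cases "t = Suc m")
          case True
          have "p k (Suc m) (X k m \<omega>) = p k (Suc m) (Z m \<omega> (k, m))"
          proof (cases "m = 0")
            case True
            then show ?thesis using p1 by simp
          next
            case False
            then have "(k, m) \<in> I" using prev kt \<open>t = Suc m\<close> by auto
            then show ?thesis by (simp add: Z_def)
          qed
          then show ?thesis
            using kt True X[OF kt \<omega>] by (simp add: q Eapp) (simp add: Z_def)
        next
          case False
          then show ?thesis using kt by (simp add: q Eapp) (auto simp: Z_def)
        qed
      qed
    qed
    \<comment> \<open>\<open>E\<close> adds the prediction at level m + 1 and
      \<open>f (Suc m)\<close> subtracts it again. The coordinates that enter the predictions up to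
      this level have earlier times and are not changed by \<open>E\<close>.\<close>
    have fE: "f m x = f (Suc m) (E x)" for x
      unfolding f_def
    proof (rule prod.cong[OF refl], clarify)
      fix k t assume kt: "(k, t) \<in> I"
      then have t0: "t \<noteq> 0" using I0 by (cases t) auto
      have same: "p k t (E x (k, t - 1)) = p k t (x (k, t - 1))" if "t \<le> Suc m"
      proof (cases "t = 1")
        case True
        then show ?thesis using p1 by metis
      next
        case False
        then have "(k, t - 1) \<in> I" using I_down[of k "t - 1"] kt t0 by simp
        moreover have "t - 1 \<noteq> Suc m" using that t0 by linarith
        ultimately show ?thesis by (simp only: Eapp if_False)
      qed
      show "g k t (x (k, t) - (if t \<le> m then p k t (x (k, t - 1)) else 0))
        = g k t (E x (k, t) - (if t \<le> Suc m then p k t (E x (k, t - 1)) else 0))"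
        using same kt by (auto simp: Eapp le_Suc_eq)
    qed
    have "distr M ?L (Z (Suc m)) = distr M ?L (E \<circ> Z m)"
      using ZS by (intro distr_cong) auto
    also have "\<dots> = distr (density ?L (f m)) ?L E"
      unfolding Suc.IH[symmetric] using shear(1) Zm by (subst distr_distr) auto
    also have "\<dots> = distr (density ?L (\<lambda>x. f (Suc m) (E x))) ?L E"
      using fE by presburger
    \<comment> \<open>Once the density is written as a function of \<open>E x\<close>, it can be
      pulled out of the image measure, which the shear leaves equal to Lebesgue measure.\<close>
    also have "\<dots> = density (distr ?L ?L E) (f (Suc m))"
      using fm shear(1) by (intro density_distr[symmetric]) auto
    also have "\<dots> = density ?L (f (Suc m))"
      using shear(2) by simp
    finally show ?case .
  qed
  \<comment> \<open>At the largest time occurring in \<open>I\<close> every coordinate has been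
    converted.\<close>
  then have "distributed M ?L (Z (Max (snd ` I))) (f (Max (snd ` I)))"
    using Zm fm by (simp add: distributed_def)
  moreover have le: "t \<le> Max (snd ` I)" if "(k, t) \<in> I" for k t
    using that fin by (force intro: Max_ge)
  then have "Z (Max (snd ` I)) = (\<lambda>\<omega>. \<lambda>(k, t)\<in>I. X k t \<omega>)"
    by (auto simp: Z_def fun_eq_iff restrict_def)
  moreover have "f (Max (snd ` I)) = (\<lambda>x. \<Prod>(k, t)\<in>I. g k t (x (k, t) - p k t (x (k, t - 1))))"
    unfolding f_def using le by (intro ext prod.cong) auto
  ultimately show ?thesis by simp
qed

section \<open>Determinant and inverse of the bridge covariance\<close>

text \<open>The discrete Laplacian (negative second difference) on the interior times with zero
  boundary values; the bridge covariance is its Green function.\<close>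

definition bridge_precision :: "nat \<Rightarrow> real Matrix.mat" where
  "bridge_precision T = Matrix.mat (T - 1) (T - 1)
     (\<lambda>(u, v). if u = v then 2 else if u = Suc v \<or> v = Suc u then -1 else 0)"

text \<open>Indexed by times rather than matrix positions, so that it also has values at the
  boundary times 0 and T, which lie outside the matrix.\<close>

definition bridge_kernel :: "nat \<Rightarrow> nat \<Rightarrow> nat \<Rightarrow> real" where
  "bridge_kernel T s t = real (min s t) * (real T - real (max s t)) / real T"

lemma bridge_cov_kernel:
  "bridge_cov T = Matrix.mat (T - 1) (T - 1) (\<lambda>(u, v). bridge_kernel T (Suc u) (Suc v))"
  by (simp add: bridge_cov_def bridge_kernel_def Let_def)

lemma dim_bridge:
  "bridge_cov T \<in> carrier_mat (T - 1) (T - 1)" "bridge_precision T \<in> carrier_mat (T - 1) (T - 1)"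
  by (simp_all add: bridge_cov_def bridge_precision_def)

lemma bridge_kernel_0: "bridge_kernel T s 0 = 0"
  by (simp add: bridge_kernel_def)

lemma bridge_kernel_T: "s \<le> T \<Longrightarrow> bridge_kernel T s T = 0"
  by (simp add: bridge_kernel_def)

text \<open>In its second argument the kernel is linear with slope (T - s) / T up to s and slope -s
  / T from s on; the slope drops by exactly 1 at s.\<close>

lemma bridge_kernel_second_difference:
  assumes "0 < s" "s < T" "Suc w < T"
  shows "2 * bridge_kernel T s (Suc w) - bridge_kernel T s w - bridge_kernel T s (Suc (Suc w))
    = (if s = Suc w then 1 else 0)"
proof -
  consider "s \<le> w" | "s = Suc w" | "Suc (Suc w) \<le> s" by linarith
  then show ?thesis
  proof cases
    case 1
    then show ?thesis using assms by (simp add: bridge_kernel_def min_def max_def field_simps)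
  next
    case 2
    then show ?thesis using assms by (simp add: bridge_kernel_def min_def max_def field_simps)
  next
    case 3
    define c where "c = (real T - real s) / real T"
    have "bridge_kernel T s (Suc w) = real (Suc w) * c" "bridge_kernel T s w = real w * c"
      "bridge_kernel T s (Suc (Suc w)) = real (Suc (Suc w)) * c"
      using 3 by (auto simp: c_def bridge_kernel_def min_def max_def)
    then show ?thesis using 3 by (simp add: algebra_simps)
  qed
qed

text \<open>Each entry of the product is a negative second difference of the kernel. In the first
  and last columns a neighbour is missing, but it belongs to time 0 or T, where the kernel
  vanishes.\<close>

lemma bridge_cov_precision: "bridge_cov T * bridge_precision T = 1\<^sub>m (T - 1)"
proof (rule eq_matI)
  fix u w assume "u < dim_row (1\<^sub>m (T - 1) :: real Matrix.mat)" "w < dim_col (1\<^sub>m (T - 1) :: real Matrix.mat)"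
  then have uw: "u < T - 1" "w < T - 1" by auto
  let ?K = "bridge_kernel T (Suc u)"
  have "(bridge_cov T * bridge_precision T) $$ (u, w)
      = (\<Sum>v<T - 1. ?K (Suc v) * (if v = w then 2 else if v = Suc w \<or> w = Suc v then -1 else 0))"
    using uw by (simp add: bridge_cov_kernel bridge_precision_def scalar_prod_def atLeast0LessThan)
  also have "\<dots> = (\<Sum>v<T - 1. 2 * (if v = w then ?K (Suc v) else 0)
      - (if Suc v = w then ?K (Suc v) else 0) - (if v = Suc w then ?K (Suc v) else 0))"
    by (intro sum.cong) auto
  also have "\<dots> = 2 * ?K (Suc w) - (\<Sum>v<T - 1. if Suc v = w then ?K (Suc v) else 0)
      - (\<Sum>v<T - 1. if v = Suc w then ?K (Suc v) else 0)"
    using uw by (simp add: sum_subtractf flip: sum_distrib_left)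
  also have "(\<Sum>v<T - 1. if Suc v = w then ?K (Suc v) else 0) = ?K w"
  proof (cases w)
    case 0
    then show ?thesis by (simp add: bridge_kernel_0)
  next
    case (Suc w')
    then show ?thesis using uw by simp
  qed
  also have "(\<Sum>v<T - 1. if v = Suc w then ?K (Suc v) else 0) = ?K (Suc (Suc w))"
  proof (cases "Suc w < T - 1")
    case False
    then have "Suc (Suc w) = T" using uw by linarith
    then show ?thesis using False uw bridge_kernel_T[of "Suc u" T] by simp
  qed simp
  also have "2 * ?K (Suc w) - ?K w - ?K (Suc (Suc w)) = 1\<^sub>m (T - 1) $$ (u, w)"
    using bridge_kernel_second_difference[of "Suc u" T w] uw by simp
  finally show "(bridge_cov T * bridge_precision T) $$ (u, w) = 1\<^sub>m (T - 1) $$ (u, w)" .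
qed (simp_all add: bridge_cov_def bridge_precision_def)

text \<open>\<open>mat_inverse\<close> returns an option. \<open>None\<close> is excluded because
  \<open>bridge_precision\<close> makes the covariance a unit; a returned matrix agrees with it by
  uniqueness of inverses.\<close>

lemma inverse_mat_bridge_cov: "inverse_mat (bridge_cov T) = bridge_precision T"
proof (cases "mat_inverse (bridge_cov T)")
  case None
  have "bridge_precision T * bridge_cov T = 1\<^sub>m (T - 1)"
    using mat_mult_left_right_inverse[OF dim_bridge bridge_cov_precision] .
  then have "bridge_cov T \<in> Units (ring_mat TYPE(real) (T - 1) ())"
    using dim_bridge[of T] bridge_cov_precision[of T] by (auto simp: Units_def ring_mat_def)
  then show ?thesis using mat_inverse(1)[OF dim_bridge(1) None, of "()"] by simp
next
  case (Some B)
  have B: "B * bridge_cov T = 1\<^sub>m (T - 1)" "B \<in> carrier_mat (T - 1) (T - 1)"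
    using mat_inverse(2)[OF dim_bridge(1) Some] by auto
  have "B = B * (bridge_cov T * bridge_precision T)"
    using B by (simp add: bridge_cov_precision)
  also have "\<dots> = (B * bridge_cov T) * bridge_precision T"
    using assoc_mult_mat[OF B(2) dim_bridge] by simp
  also have "\<dots> = bridge_precision T"
    using B dim_bridge(2)[of T] by simp
  finally show ?thesis by (simp add: inverse_mat_def Some)
qed

text \<open>The unipotent matrix \<open>A\<close> that takes the interior points to their innovations makes the
  covariance matrix upper triangular.\<close>

lemma det_bridge_cov: "Determinant.det (bridge_cov T) = (\<Prod>t\<in>{1..T - 1}. innovation_var T t)"
proof -
  \<comment> \<open>A subdiagonal entry occurs only in rows u >= 1, that is at times u + 1 >= 2,
    where \<open>innovation_var\<close> equals the regression coefficient.\<close>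
  define A where "A = Matrix.mat (T - 1) (T - 1)
    (\<lambda>(u, v). if u = v then 1 else if u = Suc v then - innovation_var T (Suc u) else 0)"
  have A: "A \<in> carrier_mat (T - 1) (T - 1)" by (simp add: A_def)
  have A_cov: "(A * bridge_cov T) $$ (u, w)
      = bridge_kernel T (Suc u) (Suc w) - innovation_var T (Suc u) * bridge_kernel T u (Suc w)"
    if uw: "u < T - 1" "w < T - 1" for u w
  proof -
    let ?K = "\<lambda>v. bridge_kernel T v (Suc w)"
    have "(A * bridge_cov T) $$ (u, w)
        = (\<Sum>v<T - 1. (if u = v then 1 else if u = Suc v then - innovation_var T (Suc u) else 0) * ?K (Suc v))"
      using uw by (simp add: A_def bridge_cov_kernel scalar_prod_def atLeast0LessThan)
    also have "\<dots> = (\<Sum>v<T - 1. (if v = u then ?K (Suc v) else 0)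
        - innovation_var T (Suc u) * (if Suc v = u then ?K (Suc v) else 0))"
      by (intro sum.cong) auto
    also have "\<dots> = ?K (Suc u) - innovation_var T (Suc u) * (\<Sum>v<T - 1. if Suc v = u then ?K (Suc v) else 0)"
      using uw by (simp add: sum_subtractf flip: sum_distrib_left)
    \<comment> \<open>Row 0 has no subdiagonal entry. The kernel at time 0 is zero, so the formula
      holds for this row as well.\<close>
    also have "(\<Sum>v<T - 1. if Suc v = u then ?K (Suc v) else 0) = ?K u"
    proof (cases u)
      case 0
      then show ?thesis by (simp add: bridge_kernel_def)
    next
      case (Suc u')
      then show ?thesis using uw by simp
    qed
    finally show ?thesis .
  qed
  have detA: "Determinant.det A = 1"
    using det_lower_triangular[OF _ A] by (simp add: A_def prod_list_diag_prod)
  have "upper_triangular (A * bridge_cov T)"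
  proof (rule upper_triangularI)
    fix u w assume "w < u" "u < dim_row (A * bridge_cov T)"
    then have uw: "u < T - 1" "w < T - 1" "w < u" by (auto simp: A_def)
    define x where "x = real T - real u - 1"
    have x: "x > 0" "real T - real u = x + 1" "real T - real (Suc u) = x" using uw by (auto simp: x_def)
    have iv: "innovation_var T (Suc u) = x / (x + 1)"
      by (simp add: innovation_var_def x_def)
    \<comment> \<open>Below the diagonal both kernel values have column time w + 1 as the earlier
      time, so their ratio is x / (x + 1) and the difference cancels.\<close>
    have "bridge_kernel T (Suc u) (Suc w) = real (Suc w) * x / real T"
      "bridge_kernel T u (Suc w) = real (Suc w) * (x + 1) / real T"
    proof -
      have "min (Suc u) (Suc w) = Suc w" "max (Suc u) (Suc w) = Suc u" "min u (Suc w) = Suc w" "max u (Suc w) = u"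
        using uw by auto
      then show "bridge_kernel T (Suc u) (Suc w) = real (Suc w) * x / real T"
        "bridge_kernel T u (Suc w) = real (Suc w) * (x + 1) / real T"
        unfolding bridge_kernel_def using x by metis+
    qed
    then show "(A * bridge_cov T) $$ (u, w) = 0"
      unfolding A_cov[OF uw(1,2)] iv using x(1) by simp
  qed
  then have "Determinant.det (A * bridge_cov T) = prod_list (diag_mat (A * bridge_cov T))"
    using A dim_bridge(1)[of T] by (intro det_upper_triangular) auto
  also have "\<dots> = (\<Prod>u<T - 1. (A * bridge_cov T) $$ (u, u))"
    using A by (simp add: prod_list_diag_prod atLeast0LessThan)
  also have "\<dots> = (\<Prod>u<T - 1. innovation_var T (Suc u))"
  proof (intro prod.cong refl)
    fix u assume "u \<in> {..<T - 1}"
    then have u: "u < T - 1" by simp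
    define x where "x = real T - real u - 1"
    have x: "x > 0" "real u = real T - x - 1" "real T - real (Suc u) = x" using u by (auto simp: x_def)
    have iv: "innovation_var T (Suc u) = x / (x + 1)"
      by (simp add: innovation_var_def x_def)
    have k: "bridge_kernel T (Suc u) (Suc u) = (real T - x) * x / real T"
      "bridge_kernel T u (Suc u) = (real T - x - 1) * x / real T"
      using x by (auto simp: bridge_kernel_def min_def max_def)
    have "\<tau> \<noteq> 0 \<Longrightarrow> y \<noteq> 0 \<Longrightarrow> y = x + 1 \<Longrightarrow>
      (\<tau> - x) * x / \<tau> - x / y * ((\<tau> - x - 1) * x / \<tau>) = x / y" for \<tau> y :: real
      by (simp add: divide_simps) (simp add: algebra_simps)
    from this[of "real T" "x + 1"] show "(A * bridge_cov T) $$ (u, u) = innovation_var T (Suc u)"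
      unfolding A_cov[OF u u] iv k using x(1) u by simp
  qed
  also have "\<dots> = (\<Prod>t\<in>{1..T - 1}. innovation_var T t)"
    by (rule prod.reindex_bij_witness[of _ "\<lambda>t. t - 1" Suc]) auto
  finally show ?thesis
    using det_mult[OF A dim_bridge(1)] detA by simp
qed

text \<open>Completion of squares in order of time, that is, the triangular factorization of the
  precision matrix. The square at time t uses 1 / v_t of the diagonal coefficient 2 of z_t^2; the
  next square uses the remaining v_(t+1).\<close>

lemma bridge_precision_quadratic_form:
  fixes z :: "nat \<Rightarrow> real"
  assumes "1 \<le> T"
  shows "(\<Sum>u<T - 1. \<Sum>v<T - 1. z (Suc u) * bridge_precision T $$ (u, v) * z (Suc v))
    = (\<Sum>t\<in>{1..T - 1}. (z t - innovation_coeff T t * z (t - 1))\<^sup>2 / innovation_var T t)"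
proof -
  define C :: "nat \<Rightarrow> nat \<Rightarrow> real"
    where "C u v = (if u = v then 2 else if u = Suc v \<or> v = Suc u then -1 else 0)" for u v
  define Q where "Q m = (\<Sum>u<m. \<Sum>v<m. z (Suc u) * C u v * z (Suc v))" for m
  have Q_Suc: "Q (Suc m) = Q m + 2 * (z (Suc m))\<^sup>2 - 2 * (if m = 0 then 0 else z m * z (Suc m))" for m
  proof -
    have one: "(\<Sum>u<m. z (Suc u) * C u m * z (Suc m)) = - (if m = 0 then 0 else z m * z (Suc m))"
    proof (cases m)
      case (Suc m')
      have "(\<Sum>u<m. z (Suc u) * C u m * z (Suc m)) = (\<Sum>u<m. if u = m' then - (z (Suc u) * z (Suc m)) else 0)"
        unfolding C_def Suc by (intro sum.cong) auto
      then show ?thesis using Suc by simp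
    qed simp
    have sym: "C u v = C v u" for u v by (auto simp: C_def)
    have "(\<Sum>v<m. z (Suc m) * C m v * z (Suc v)) = (\<Sum>u<m. z (Suc u) * C u m * z (Suc m))"
      by (intro sum.cong) (simp_all add: sym[of m])
    moreover have "C m m = 2" by (simp add: C_def)
    ultimately show ?thesis
      using one by (simp add: Q_def sum.distrib power2_eq_square)
  qed
  \<comment> \<open>The partial sums lack the part of the next square that is quadratic in \<open>z\<^sub>m\<close>.\<close>
  have partial: "m < T \<Longrightarrow> (\<Sum>t\<in>{1..m}. (z t - innovation_coeff T t * z (t - 1))\<^sup>2 / innovation_var T t)
      = Q m - (if m = 0 then 0 else innovation_var T (Suc m) * (z m)\<^sup>2)" for m
  proof (induction m)
    case 0
    then show ?case by (simp add: Q_def)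
  next
    case (Suc m)
    define x where "x = real T - real (Suc m)"
    have x: "x > 0" using Suc.prems by (simp add: x_def)
    have iv: "innovation_var T (Suc m) = x / (x + 1)" "innovation_var T (Suc (Suc m)) = (x - 1) / x"
    proof -
      have "real T - real (Suc (Suc m)) = x - 1" by (simp add: x_def)
      then show "innovation_var T (Suc m) = x / (x + 1)" "innovation_var T (Suc (Suc m)) = (x - 1) / x"
        by (simp_all add: innovation_var_def del: of_nat_Suc flip: x_def)
    qed
    \<comment> \<open>With x = T - t and t = m + 1, this is 1 / v_t = 2 - v_(t+1).\<close>
    have split: "(z (Suc m))\<^sup>2 / (x / (x + 1)) = 2 * (z (Suc m))\<^sup>2 - (x - 1) / x * (z (Suc m))\<^sup>2"
      using x by (simp add: field_simps)
    show ?case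
    proof (cases "m = 0")
      case True
      have "innovation_var T (Suc 0) = x / (x + 1)" "Q 0 = 0"
        using iv(1) True by (simp_all add: Q_def)
      then show ?thesis
        using split True iv(2) by (simp add: Q_Suc innovation_coeff_def)
    next
      case False
      have \<rho>: "innovation_coeff T (Suc m) = x / (x + 1)"
        using False by (simp add: innovation_coeff_def x_def)
      have "(z (Suc m) - x / (x + 1) * z m)\<^sup>2 / (x / (x + 1))
          = (z (Suc m))\<^sup>2 / (x / (x + 1)) - 2 * (z m * z (Suc m)) + x / (x + 1) * (z m)\<^sup>2"
      proof -
        \<comment> \<open>Here c is both coefficient and variance, so the cross term has coefficient
          exactly -2, matching the two off-diagonal entries -1.\<close>
        have "c \<noteq> 0 \<Longrightarrow> (p - c * q)\<^sup>2 / c = p\<^sup>2 / c - 2 * (q * p) + c * q\<^sup>2" for p q c :: real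
          by (simp add: field_simps power2_eq_square)
        then show ?thesis by this (use x in simp)
      qed
      then show ?thesis
        using Suc False split by (simp add: Q_Suc iv \<rho>)
    qed
  qed
  \<comment> \<open>The correction left after the last interior time has coefficient v_T = 0, so the
    completed squares account for the whole form.\<close>
  have "innovation_var T T = 0" by (simp add: innovation_var_def)
  moreover have "(\<Sum>u<T - 1. \<Sum>v<T - 1. z (Suc u) * bridge_precision T $$ (u, v) * z (Suc v)) = Q (T - 1)"
    by (simp add: Q_def C_def bridge_precision_def)
  ultimately show ?thesis using partial[of "T - 1"] assms by simp
qed

lemma matrix_inv_unique:
  fixes A :: "'b::semiring_1^'n^'n"
  assumes "A ** B = Finite_Cartesian_Product.mat 1" "B ** A = Finite_Cartesian_Product.mat 1"
  shows "matrix_inv A = B"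
proof -
  have "invertible A" using assms by (auto simp: invertible_def)
  then have "matrix_inv A = matrix_inv A ** (A ** B)" by (simp add: assms)
  also have "\<dots> = B" using \<open>invertible A\<close> by (simp add: matrix_mul_assoc matrix_inv_left)
  finally show ?thesis .
qed

lemma matrix_conj_by:
  "(V :: real^'d^'d) ** conj_by D C ** Finite_Cartesian_Product.transpose V = conj_by (\<lambda>t. V *v D t) C"
proof -
  have "(V ** conj_by D C ** Finite_Cartesian_Product.transpose V) $ k $ l = conj_by (\<lambda>t. V *v D t) C $ k $ l" for k l
  proof -
    have "(V ** conj_by D C ** Finite_Cartesian_Product.transpose V) $ k $ l
      = (\<Sum>j\<in>UNIV. \<Sum>i\<in>UNIV. \<Sum>u<dim_row C. \<Sum>v<dim_col C.
          V $ k $ i * D (u + 1) $ i * C $$ (u, v) * (V $ l $ j * D (v + 1) $ j))"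
      by (simp add: matrix_matrix_mult_def Finite_Cartesian_Product.transpose_def conj_by_def
          sum_distrib_left sum_distrib_right mult_ac)
    also have "\<dots> = (\<Sum>j\<in>UNIV. \<Sum>u<dim_row C. \<Sum>v<dim_col C. \<Sum>i\<in>UNIV.
          V $ k $ i * D (u + 1) $ i * C $$ (u, v) * (V $ l $ j * D (v + 1) $ j))"
      by (subst sum.swap, subst (2) sum.swap) (rule refl)
    also have "\<dots> = (\<Sum>u<dim_row C. \<Sum>v<dim_col C. \<Sum>j\<in>UNIV. \<Sum>i\<in>UNIV.
          V $ k $ i * D (u + 1) $ i * C $$ (u, v) * (V $ l $ j * D (v + 1) $ j))"
      by (subst sum.swap, subst (2) sum.swap) (rule refl)
    also have "\<dots> = conj_by (\<lambda>t. V *v D t) C $ k $ l"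
      by (simp add: conj_by_def matrix_vector_mult_def sum_distrib_left sum_distrib_right)
    finally show ?thesis .
  qed
  then show ?thesis by (simp add: Finite_Cartesian_Product.vec_eq_iff)
qed

text \<open>With V the inverse of W, \<Sigma>^-1 = V^T V, and cyclicity of the trace gives the trace
  of (V D) P (V D)^T. This is a sum over components of scalar quadratic forms, to each of which the
  completion of squares applies. \<open>D 0\<close> appears on the right only with coefficient
  0.\<close>

lemma trace_conj_by_bridge:
  fixes W :: "real^'d^'d" and D :: "nat \<Rightarrow> real^'d"
  assumes W: "Determinants.det W \<noteq> 0" and T: "1 \<le> T"
  shows "trace (matrix_inv (W ** Finite_Cartesian_Product.transpose W) ** conj_by D (inverse_mat (bridge_cov T)))
    = (\<Sum>t\<in>{1..T - 1}. (\<Sum>k\<in>UNIV. ((matrix_inv W *v (D t - innovation_coeff T t *\<^sub>R D (t - 1))) $ k)\<^sup>2)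
        / innovation_var T t)"
proof -
  let ?V = "matrix_inv W" and ?P = "bridge_precision T"
  have VW: "?V ** W = Finite_Cartesian_Product.mat 1" and WV: "W ** ?V = Finite_Cartesian_Product.mat 1"
    using W by (simp_all add: matrix_inv_left matrix_inv_right invertible_det_nz)
  have t1: "Finite_Cartesian_Product.transpose ?V ** Finite_Cartesian_Product.transpose W = Finite_Cartesian_Product.mat 1"
    "Finite_Cartesian_Product.transpose W ** Finite_Cartesian_Product.transpose ?V = Finite_Cartesian_Product.mat 1"
    by (simp_all add: VW WV flip: matrix_transpose_mul)
  have inv: "matrix_inv (W ** Finite_Cartesian_Product.transpose W) = Finite_Cartesian_Product.transpose ?V ** ?V"
  proof (rule matrix_inv_unique)
    have "W ** Finite_Cartesian_Product.transpose W ** (Finite_Cartesian_Product.transpose ?V ** ?V)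
      = W ** (Finite_Cartesian_Product.transpose W ** Finite_Cartesian_Product.transpose ?V) ** ?V"
      by (simp only: matrix_mul_assoc)
    then show "W ** Finite_Cartesian_Product.transpose W ** (Finite_Cartesian_Product.transpose ?V ** ?V)
      = Finite_Cartesian_Product.mat 1"
      by (simp add: t1 WV)
    have "Finite_Cartesian_Product.transpose ?V ** ?V ** (W ** Finite_Cartesian_Product.transpose W)
      = Finite_Cartesian_Product.transpose ?V ** (?V ** W) ** Finite_Cartesian_Product.transpose W"
      by (simp only: matrix_mul_assoc)
    then show "Finite_Cartesian_Product.transpose ?V ** ?V ** (W ** Finite_Cartesian_Product.transpose W)
      = Finite_Cartesian_Product.mat 1"
      by (simp add: t1 VW)
  qed
  have "trace (matrix_inv (W ** Finite_Cartesian_Product.transpose W) ** conj_by D ?P)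
      = trace (?V ** conj_by D ?P ** Finite_Cartesian_Product.transpose ?V)"
    unfolding inv matrix_mul_assoc[symmetric] by (subst trace_mul_sym) (simp only: matrix_mul_assoc)
  also have "\<dots> = (\<Sum>k\<in>UNIV. \<Sum>u<T - 1. \<Sum>v<T - 1. (?V *v D (Suc u)) $ k * ?P $$ (u, v) * (?V *v D (Suc v)) $ k)"
    unfolding matrix_conj_by using dim_bridge(2)[of T] by (simp add: trace_def conj_by_def)
  also have "\<dots> = (\<Sum>k\<in>UNIV. \<Sum>t\<in>{1..T - 1}.
      ((?V *v D t) $ k - innovation_coeff T t * (?V *v D (t - 1)) $ k)\<^sup>2 / innovation_var T t)"
    by (intro sum.cong refl bridge_precision_quadratic_form T)
  also have "\<dots> = (\<Sum>t\<in>{1..T - 1}. (\<Sum>k\<in>UNIV. ((?V *v (D t - innovation_coeff T t *\<^sub>R D (t - 1))) $ k)\<^sup>2)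
        / innovation_var T t)"
    by (subst sum.swap) (simp add: sum_divide_distrib matrix_vector_mult_diff_distrib matrix_vector_mult_scaleR)
  finally show ?thesis by (simp add: inverse_mat_bridge_cov)
qed

section \<open>The log-likelihood\<close>

lemma innovation_var_pos: "t \<in> {1..T - 1} \<Longrightarrow> 0 < innovation_var T t"
  by (auto simp: innovation_var_def intro!: divide_pos_pos)

context prob_space
begin

text \<open>The means cancel, leaving \<open>W\<close> applied to the vector of scalar innovations.
  Those are independent over all pairs (component, time); grouping the pairs by time gives
  independent vectors, and fixing a time gives independent components.\<close>

lemma bridge_model_innovations:
  fixes S :: "nat \<Rightarrow> 'a \<Rightarrow> real^'d"
  assumes model: "bridge_model M W T a b S" and T: "2 \<le> T" and W: "Determinants.det W \<noteq> 0"
  defines "G \<equiv> \<lambda>t \<omega>. (S t \<omega> - bridge_mean a b T t)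
    - innovation_coeff T t *\<^sub>R (S (t - 1) \<omega> - bridge_mean a b T (t - 1))"
  shows "indep_vars (\<lambda>_. borel) G {1..T - 1}"
    and "t \<in> {1..T - 1} \<Longrightarrow> distr M borel (G t) = density lborel (linear_normal_density W (innovation_var T t))"
proof -
  obtain B :: "'d \<Rightarrow> real \<Rightarrow> 'a \<Rightarrow> real" where
    bb: "\<And>k. brownian_bridge M (real T) (B k)"
    and indB: "indep_vars (\<lambda>_. Pi\<^sub>M {0..real T} (\<lambda>_. borel)) (\<lambda>k \<omega>. \<lambda>t\<in>{0..real T}. B k t \<omega>) UNIV"
    and S: "\<And>t \<omega>. t \<in> {0..T} \<Longrightarrow> \<omega> \<in> space M \<Longrightarrow>
      S t \<omega> = bridge_mean a b T t + W *v (\<chi> k. B k (real t) \<omega>)"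
    using model unfolding bridge_model_def by blast
  define D where "D k t \<omega> = B k (real t) \<omega> - innovation_coeff T t * B k (real (t - 1)) \<omega>" for k t \<omega>
  have innov: "indep_vars (\<lambda>_. borel) (D k) {1..T - 1}"
    "t \<in> {1..T - 1} \<Longrightarrow> normal_law M (D k t) 0 (innovation_var T t)" for k t
    unfolding D_def[abs_def] using bridge_innovations[OF bb T] by blast+
  let ?J = "{1..T - 1}"
  have J: "?J \<noteq> {}" using T by auto
  \<comment> \<open>The innovations of component k are a measurable function of its path alone, so
    independence of paths passes to these blocks.\<close>
  have "indep_vars (\<lambda>_. PiM ?J (\<lambda>_. borel)) (\<lambda>k \<omega>. \<lambda>t\<in>?J. D k t \<omega>) UNIV"
  proof -
    let ?Y = "\<lambda>f. \<lambda>t\<in>?J. f (real t) - innovation_coeff T t * f (real (t - 1))"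
    have "?Y \<in> measurable (PiM {0..real T} (\<lambda>_. borel)) (PiM ?J (\<lambda>_. borel))"
    proof (rule measurable_restrict)
      fix t assume "t \<in> ?J"
      then have "real t \<in> {0..real T}" "real (t - 1) \<in> {0..real T}" by auto
      then show "(\<lambda>f. f (real t) - innovation_coeff T t * f (real (t - 1)))
        \<in> borel_measurable (PiM {0..real T} (\<lambda>_. borel))"
        by (intro borel_measurable_diff borel_measurable_times borel_measurable_const measurable_component_singleton)
    qed
    then have "indep_vars (\<lambda>_. PiM ?J (\<lambda>_. borel)) (\<lambda>k \<omega>. ?Y (\<lambda>t\<in>{0..real T}. B k t \<omega>)) UNIV"
      by (rule indep_vars_compose2[OF indB, where Y="\<lambda>_. ?Y"])
    moreover have "?Y (\<lambda>t\<in>{0..real T}. B k t \<omega>) = (\<lambda>t\<in>?J. D k t \<omega>)" for k \<omega>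
      by (auto simp: D_def fun_eq_iff restrict_def)
    ultimately show ?thesis by simp
  qed
  then have "indep_vars (\<lambda>(k, t). borel) (\<lambda>(k, t). D k t) (UNIV \<times> ?J)"
    using J by (intro indep_vars_Sigma innov(1)) auto
  then have ind: "indep_vars (\<lambda>_. borel) (\<lambda>(k, t). D k t) (UNIV \<times> ?J)"
    by (simp add: case_prod_unfold)
  \<comment> \<open>Regrouping by time: the column of pairs with a given t feeds the vector
    innovation at t, and different columns are disjoint.\<close>
  have "indep_vars (\<lambda>t. PiM (UNIV \<times> {t}) (\<lambda>_. borel))
      (\<lambda>t \<omega>. restrict (\<lambda>q. (\<lambda>(k, t). D k t) q \<omega>) (UNIV \<times> {t})) ?J"
    by (rule indep_vars_restrict[OF ind]) (auto simp: disjoint_family_on_def)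
  then have "indep_vars (\<lambda>_. borel)
      (\<lambda>t \<omega>. W *v (\<chi> k. restrict (\<lambda>q. (\<lambda>(k, t). D k t) q \<omega>) (UNIV \<times> {t}) (k, t))) ?J"
  proof (rule indep_vars_compose2)
    fix t
    have "(\<lambda>f. \<chi> k. f (k, t)) \<in> measurable (PiM (UNIV \<times> {t}) (\<lambda>_. borel)) (borel :: (real^'d) measure)"
      by (subst borel_measurable_euclidean_space)
         (auto simp: Basis_vec_def inner_axis intro!: measurable_component_singleton)
    then show "(\<lambda>f. W *v (\<chi> k. f (k, t))) \<in> borel_measurable (PiM (UNIV \<times> {t}) (\<lambda>_. borel))"
      by (rule measurable_compose) measurable
  qed
  then have indW: "indep_vars (\<lambda>_. borel) (\<lambda>t \<omega>. W *v (\<chi> k. D k t \<omega>)) ?J"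
    by simp
  have G: "W *v (\<chi> k. D k t \<omega>) = G t \<omega>" if "t \<in> ?J" "\<omega> \<in> space M" for t \<omega>
  proof -
    have t: "t \<in> {0..T}" "t - 1 \<in> {0..T}" using that by auto
    have "(\<chi> k. D k t \<omega>) = (\<chi> k. B k (real t) \<omega>) - innovation_coeff T t *\<^sub>R (\<chi> k. B k (real (t - 1)) \<omega>)"
      by (simp add: D_def Finite_Cartesian_Product.vec_eq_iff)
    then show ?thesis
      by (simp only: G_def S[OF t(1) that(2)] S[OF t(2) that(2)] matrix_vector_mult_diff_distrib
          matrix_vector_mult_scaleR add_diff_cancel_left')
  qed
  show "indep_vars (\<lambda>_. borel) G ?J"
    by (rule indep_vars_cong_space[OF indW G])
  show "distr M borel (G t) = density lborel (linear_normal_density W (innovation_var T t))" if t: "t \<in> ?J"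
  proof -
    have "indep_vars (\<lambda>_. borel) (\<lambda>k. D k t) UNIV"
    proof -
      have "indep_vars (\<lambda>k. PiM {(k, t)} (\<lambda>_. borel)) (\<lambda>k \<omega>. restrict (\<lambda>q. (\<lambda>(k, t). D k t) q \<omega>) {(k, t)}) UNIV"
        by (rule indep_vars_restrict[OF ind]) (use t in \<open>auto simp: disjoint_family_on_def\<close>)
      then have "indep_vars (\<lambda>_. borel) (\<lambda>k \<omega>. restrict (\<lambda>q. (\<lambda>(k, t). D k t) q \<omega>) {(k, t)} (k, t)) UNIV"
        by (rule indep_vars_compose2[where Y="\<lambda>k f. f (k, t)"]) auto
      then show ?thesis by simp
    qed
    then have "distr M borel (\<lambda>\<omega>. W *v (\<chi> k. D k t \<omega>))
        = density lborel (linear_normal_density W (innovation_var T t))"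
      by (rule distr_linear_normal) (use innov(2) t innovation_var_pos W in auto)
    moreover have "distr M borel (G t) = distr M borel (\<lambda>\<omega>. W *v (\<chi> k. D k t \<omega>))"
      using G[OF t] by (intro distr_cong) auto
    ultimately show ?thesis by simp
  qed
qed

end

text \<open>Pulling out the factor 1/2 doubles the logarithm of |det W|, so that this term becomes
  the logarithm of det \<Sigma> once \<Sigma> is substituted.\<close>

lemma ln_linear_normal_density:
  fixes W :: "real^'d^'d"
  assumes v: "0 < v" and W: "Determinants.det W \<noteq> 0"
  shows "0 < linear_normal_density W v y"
    and "ln (linear_normal_density W v y) = - (real CARD('d) * ln (2 * pi) + real CARD('d) * ln v
      + 2 * ln \<bar>Determinants.det W\<bar> + (\<Sum>k\<in>UNIV. ((matrix_inv W *v y) $ k)\<^sup>2) / v) / 2"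
proof -
  have pos: "0 < normal_density 0 (sqrt v) z" for z using v by (simp add: normal_density_pos)
  have ln_nd: "ln (normal_density 0 (sqrt v) z) = - (ln (2 * pi) + ln v + z\<^sup>2 / v) / 2" for z
    using v by (simp add: normal_density_def ln_mult ln_div ln_sqrt field_simps)
  show "0 < linear_normal_density W v y"
    using pos W by (simp add: linear_normal_density_def prod_pos)
  have "ln (linear_normal_density W v y)
      = (\<Sum>k\<in>UNIV. ln (normal_density 0 (sqrt v) ((matrix_inv W *v y) $ k))) - ln \<bar>Determinants.det W\<bar>"
    using pos W by (simp add: linear_normal_density_def ln_div prod_pos ln_prod less_imp_neq[THEN not_sym])
  also have "\<dots> = - (real CARD('d) * ln (2 * pi) + real CARD('d) * ln v
      + 2 * ln \<bar>Determinants.det W\<bar> + (\<Sum>k\<in>UNIV. ((matrix_inv W *v y) $ k)\<^sup>2) / v) / 2"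
    unfolding ln_nd by (simp only: sum_divide_distrib[symmetric] sum_negf sum.distrib sum_constant) argo
  finally show "ln (linear_normal_density W v y) = \<dots>" .
qed

theorem proposition1:
  fixes M :: "'a measure"
    and n :: nat
    and T :: "nat \<Rightarrow> nat"
    and W \<Sigma> :: "real^'d^'d"
    and a b :: "nat \<Rightarrow> real^'d"
    and S :: "nat \<Rightarrow> nat \<Rightarrow> 'a \<Rightarrow> real^'d"
  assumes "prob_space M"
    and "1 \<le> n"
    and "\<And>i. i \<in> {1..n} \<Longrightarrow> 2 \<le> T i"
    and "\<Sigma> = W ** Finite_Cartesian_Product.transpose W"
    and "positive_definite \<Sigma>"
    and "\<And>i. i \<in> {1..n} \<Longrightarrow> bridge_model M W (T i) (a i) (b i) (S i)"
    and "prob_space.indep_vars M (\<lambda>i. Pi\<^sub>M {0..T i} (\<lambda>_. borel))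
           (\<lambda>i \<omega>. \<lambda>t\<in>{0..T i}. S i t \<omega>) {1..n}"
  shows "is_log_likelihood M (interior_lebesgue n T) (interior_points n T S)
    (\<lambda>x. 1 / 2 *
      (- real CARD('d) * ln (2 * pi) * (\<Sum>i=1..n. real (T i - 1))
       - real CARD('d) * (\<Sum>i=1..n. ln (Determinant.det (bridge_cov (T i))))
       - ln (Determinants.det \<Sigma>) * (\<Sum>i=1..n. real (T i - 1))
       - (\<Sum>i=1..n. trace (matrix_inv \<Sigma> **
            conj_by (\<lambda>t. x (i, t) - bridge_mean (a i) (b i) (T i) t)
              (inverse_mat (bridge_cov (T i)))))))"
proof -
  interpret prob_space M by fact
  let ?I = "interior_index n T"
  have I: "finite ?I" "?I \<noteq> {}"
  proof -
    have "(1, 1) \<in> ?I" using assms(2) assms(3)[of 1] by (simp add: interior_index_def)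
    then show "?I \<noteq> {}" by blast
  qed (simp add: interior_index_def)
  have det\<Sigma>: "Determinants.det \<Sigma> = (Determinants.det W)\<^sup>2"
    by (simp add: assms(4) Determinants.det_mul power2_eq_square)
  \<comment> \<open>Positive definiteness enters through a trivial kernel: it makes \<Sigma>
    invertible, and det \<Sigma> = (det W)^2 carries this over to \<open>W\<close>.\<close>
  have "inj ((*v) \<Sigma>)"
  proof (rule injI)
    fix x y assume "\<Sigma> *v x = \<Sigma> *v y"
    then have "(x - y) \<bullet> (\<Sigma> *v (x - y)) = 0" by (simp add: matrix_vector_mult_diff_distrib)
    then show "x = y" using assms(5) unfolding positive_definite_def by (metis less_irrefl right_minus_eq)
  qed
  then have "Determinants.det \<Sigma> \<noteq> 0"
    using matrix_left_invertible_injective invertible_left_inverse invertible_det_nz by blast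
  then have W: "Determinants.det W \<noteq> 0" by (simp add: det\<Sigma>)
  define \<mu> where "\<mu> i t = bridge_mean (a i) (b i) (T i) t" for i t
  define \<rho> where "\<rho> i t = innovation_coeff (T i) t" for i t
  define v where "v i t = innovation_var (T i) t" for i t
  define G where "G i t \<omega> = (S i t \<omega> - \<mu> i t) - \<rho> i t *\<^sub>R (S i (t - 1) \<omega> - \<mu> i (t - 1))" for i t \<omega>
  \<comment> \<open>The prediction of the point at time t from the point y at time t - 1;
    \<open>G\<close> is the observed point minus this prediction.\<close>
  define p where "p i t y = \<mu> i t + \<rho> i t *\<^sub>R (y - \<mu> i (t - 1))" for i t y
  define f where "f x = (\<Prod>(i, t)\<in>?I. linear_normal_density W (v i t) (x (i, t) - p i t (x (i, t - 1))))" for x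
  have G_props: "indep_vars (\<lambda>_. borel) (G i) {1..T i - 1}"
    "t \<in> {1..T i - 1} \<Longrightarrow> distr M borel (G i t) = density lborel (linear_normal_density W (v i t))"
    if "i \<in> {1..n}" for i t
    unfolding G_def[abs_def] \<mu>_def \<rho>_def v_def
    using bridge_model_innovations[OF assms(6)[OF that] assms(3)[OF that] W] by blast+
  have G_ind: "indep_vars (\<lambda>_. borel) (\<lambda>(i, t). G i t) ?I"
  proof -
    \<comment> \<open>All innovations of sequence i are a measurable function of that sequence, so
      independence of the sequences passes to their blocks of innovations.\<close>
    let ?Y = "\<lambda>i f. \<lambda>t\<in>{1..T i - 1}. (f t - \<mu> i t) - \<rho> i t *\<^sub>R (f (t - 1) - \<mu> i (t - 1))"
    have "?Y i \<in> measurable (PiM {0..T i} (\<lambda>_. borel)) (PiM {1..T i - 1} (\<lambda>_. borel))" for i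
    proof (rule measurable_restrict)
      fix t assume "t \<in> {1..T i - 1}"
      then have "t \<in> {0..T i}" "t - 1 \<in> {0..T i}" by auto
      then show "(\<lambda>f. (f t - \<mu> i t) - \<rho> i t *\<^sub>R (f (t - 1) - \<mu> i (t - 1)))
        \<in> borel_measurable (PiM {0..T i} (\<lambda>_. borel))"
        by (intro borel_measurable_diff borel_measurable_scaleR borel_measurable_const measurable_component_singleton)
    qed
    then have "indep_vars (\<lambda>i. PiM {1..T i - 1} (\<lambda>_. borel)) (\<lambda>i \<omega>. ?Y i (\<lambda>t\<in>{0..T i}. S i t \<omega>)) {1..n}"
      by (intro indep_vars_compose2[OF assms(7)])
    moreover have "?Y i (\<lambda>t\<in>{0..T i}. S i t \<omega>) = (\<lambda>t\<in>{1..T i - 1}. G i t \<omega>)" for i \<omega>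
      by (auto simp: G_def fun_eq_iff restrict_def)
    ultimately have "indep_vars (\<lambda>i. PiM {1..T i - 1} (\<lambda>_. borel)) (\<lambda>i \<omega>. \<lambda>t\<in>{1..T i - 1}. G i t \<omega>) {1..n}"
      by simp
    then have "indep_vars (\<lambda>(i, t). borel) (\<lambda>(i, t). G i t) (SIGMA i:{1..n}. {1..T i - 1})"
    proof (rule indep_vars_Sigma[rotated -2])
      show "indep_vars (\<lambda>_. borel) (G i) {1..T i - 1}" if "i \<in> {1..n}" for i
        by (rule G_props(1)[OF that])
      show "{1..T i - 1} \<noteq> {}" if "i \<in> {1..n}" for i
        using assms(3)[OF that] by auto
    qed (use assms(2) in auto)
    then show ?thesis by (simp add: interior_index_def case_prod_unfold)
  qed
  have S_meas: "S i t \<in> borel_measurable M" if "(i, t) \<in> ?I" for i t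
  proof -
    have "i \<in> {1..n}" "t \<in> {0..T i}" using that by (auto simp: interior_index_def)
    then have "(\<lambda>\<omega>. \<lambda>t\<in>{0..T i}. S i t \<omega>) \<in> measurable M (PiM {0..T i} (\<lambda>_. borel))"
      using assms(7) unfolding indep_vars_def by blast
    then have "(\<lambda>\<omega>. (\<lambda>t\<in>{0..T i}. S i t \<omega>) t) \<in> borel_measurable M"
      by (rule measurable_compose[OF _ measurable_component_singleton]) fact
    then show ?thesis using \<open>t \<in> {0..T i}\<close> by simp
  qed
  have "distributed M (PiM ?I (\<lambda>_. lborel)) (\<lambda>\<omega>. \<lambda>(i, t)\<in>?I. S i t \<omega>)
      (\<lambda>x. \<Prod>(i, t)\<in>?I. ennreal (linear_normal_density W (v i t) (x (i, t) - p i t (x (i, t - 1)))))"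
  proof (rule distributed_autoregression[where G=G and g="\<lambda>i t y. ennreal (linear_normal_density W (v i t) y)"])
    show "p i t \<in> borel_measurable borel" for i t
      unfolding p_def[abs_def] by measurable
    show "p i 1 y = p i 1 z" for i y z
      by (simp add: p_def \<rho>_def innovation_coeff_def)
    show "distr M borel (G i t) = density lborel (\<lambda>y. ennreal (linear_normal_density W (v i t) y))"
      if "(i, t) \<in> ?I" for i t
      using G_props(2) that by (auto simp: interior_index_def)
    show "S i t \<omega> = G i t \<omega> + p i t (S i (t - 1) \<omega>)" for i t \<omega>
      by (simp add: G_def p_def)
  qed (use I G_ind S_meas in \<open>auto simp: interior_index_def\<close>)
  moreover have "(\<lambda>x. \<Prod>(i, t)\<in>?I. ennreal (linear_normal_density W (v i t) (x (i, t) - p i t (x (i, t - 1)))))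
      = (\<lambda>x. ennreal (f x))"
    unfolding f_def
    by (auto simp: fun_eq_iff case_prod_unfold linear_normal_density_def prod_nonneg intro!: prod_ennreal)
  ultimately have dist: "distributed M (interior_lebesgue n T) (interior_points n T S) (\<lambda>x. ennreal (f x))"
    unfolding interior_lebesgue_def interior_points_def[abs_def] by simp
  have v_pos: "0 < v i t" if "(i, t) \<in> ?I" for i t
    using innovation_var_pos that by (auto simp: v_def interior_index_def)
  have f_pos: "0 < f x" for x
    unfolding f_def using ln_linear_normal_density(1)[OF v_pos W] by (intro prod_pos) auto
  have "ln (f x) = 1 / 2 *
      (- real CARD('d) * ln (2 * pi) * (\<Sum>i=1..n. real (T i - 1))
       - real CARD('d) * (\<Sum>i=1..n. ln (Determinant.det (bridge_cov (T i))))
       - ln (Determinants.det \<Sigma>) * (\<Sum>i=1..n. real (T i - 1))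
       - (\<Sum>i=1..n. trace (matrix_inv \<Sigma> **
            conj_by (\<lambda>t. x (i, t) - bridge_mean (a i) (b i) (T i) t)
              (inverse_mat (bridge_cov (T i))))))" for x
  proof -
    define y where "y i t = x (i, t) - \<mu> i t" for i t
    define q where "q i t = (\<Sum>k\<in>UNIV. ((matrix_inv W *v (y i t - \<rho> i t *\<^sub>R y i (t - 1))) $ k)\<^sup>2) / v i t" for i t
    \<comment> \<open>The part of each factor's log-density that is the same for all indices; summed
      over a sequence it is multiplied by T i - 1.\<close>
    define c where "c = real CARD('d) * ln (2 * pi) + 2 * ln \<bar>Determinants.det W\<bar>"
    have "ln (f x) = (\<Sum>(i, t)\<in>?I. ln (linear_normal_density W (v i t) (x (i, t) - p i t (x (i, t - 1)))))"
      unfolding f_def using ln_linear_normal_density(1)[OF v_pos W] I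
      by (subst ln_prod) (auto simp: case_prod_unfold less_imp_neq[THEN not_sym])
    also have "\<dots> = (\<Sum>(i, t)\<in>?I. - (c + real CARD('d) * ln (v i t) + q i t) / 2)"
    proof (intro sum.cong refl, clarify)
      fix i t assume it: "(i, t) \<in> ?I"
      have "x (i, t) - p i t (x (i, t - 1)) = y i t - \<rho> i t *\<^sub>R y i (t - 1)"
        by (simp add: p_def y_def)
      then show "ln (linear_normal_density W (v i t) (x (i, t) - p i t (x (i, t - 1))))
          = - (c + real CARD('d) * ln (v i t) + q i t) / 2"
        using ln_linear_normal_density(2)[OF v_pos[OF it] W] by (simp add: q_def c_def)
    qed
    also have "\<dots> = (\<Sum>i=1..n. \<Sum>t=1..T i - 1. - (c + real CARD('d) * ln (v i t) + q i t) / 2)"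
      unfolding interior_index_def by (subst sum.Sigma) auto
    also have "\<dots> = (\<Sum>i=1..n. - (c * real (T i - 1) + real CARD('d) * ln (Determinant.det (bridge_cov (T i)))
        + trace (matrix_inv \<Sigma> ** conj_by (\<lambda>t. y i t) (inverse_mat (bridge_cov (T i))))) / 2)"
    proof (intro sum.cong refl)
      fix i assume i: "i \<in> {1..n}"
      \<comment> \<open>The innovation variances multiply to the determinant of the bridge
        covariance, so their logarithms, like the squares \<open>q\<close>, collapse to one term per
        sequence.\<close>
      have "ln (Determinant.det (bridge_cov (T i))) = (\<Sum>t=1..T i - 1. ln (v i t))"
        unfolding det_bridge_cov v_def
        by (subst ln_prod) (simp_all add: innovation_var_pos[THEN less_imp_neq, THEN not_sym])
      moreover have "trace (matrix_inv \<Sigma> ** conj_by (\<lambda>t. y i t) (inverse_mat (bridge_cov (T i)))) = (\<Sum>t=1..T i - 1. q i t)"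
        unfolding assms(4) q_def v_def \<rho>_def using assms(3)[OF i] by (intro trace_conj_by_bridge W) auto
      ultimately show "(\<Sum>t=1..T i - 1. - (c + real CARD('d) * ln (v i t) + q i t) / 2)
        = - (c * real (T i - 1) + real CARD('d) * ln (Determinant.det (bridge_cov (T i)))
          + trace (matrix_inv \<Sigma> ** conj_by (\<lambda>t. y i t) (inverse_mat (bridge_cov (T i))))) / 2"
        by (simp add: sum_divide_distrib[symmetric] sum_negf sum.distrib sum_subtractf sum_distrib_left mult.commute)
    qed
    also have "\<dots> = - (c * (\<Sum>i=1..n. real (T i - 1)) + real CARD('d) * (\<Sum>i=1..n. ln (Determinant.det (bridge_cov (T i))))
        + (\<Sum>i=1..n. trace (matrix_inv \<Sigma> ** conj_by (\<lambda>t. y i t) (inverse_mat (bridge_cov (T i)))))) / 2"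
      by (simp only: sum_divide_distrib[symmetric] sum_negf sum.distrib sum_distrib_left)
    finally have ln_f: "ln (f x) = \<dots>" .
    have "ln (Determinants.det \<Sigma>) = 2 * ln \<bar>Determinants.det W\<bar>"
      using ln_realpow[of "\<bar>Determinants.det W\<bar>" 2] W by (simp add: det\<Sigma>)
    then have "c = real CARD('d) * ln (2 * pi) + ln (Determinants.det \<Sigma>)" by (simp add: c_def)
    then show ?thesis
      using ln_f unfolding y_def \<mu>_def by (simp add: algebra_simps)
  qed
  then show ?thesis
    unfolding is_log_likelihood_def using dist f_pos by (intro exI[of _ f]) simp
qed

end
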